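(* Let $F:[0,\infty)\to\mathcal{L}(\mathfrak{H})$ be a measurable family of non-negative self-adjoint contractions on a Hilbert space $\mathfrak{H}$ such that $F(0)=\mathds{1}$. For $\tau>0$ put $S(\tau):=(\mathds{1}-F(\tau))/\tau$, and let $H\ge0$ be a self-adjoint operator in $\mathfrak{H}$ such that $\operatorname{s-lim}_{\tau\to+0}(\mathds{1}+S(\tau))^{-1}=(\mathds{1}+H)^{-1}$. If there is a constant $M_1>0$ such that $$\|(\mathds{1}+S(\tau))^{-1}-(\mathds{1}+H)^{-1}\|\le M_1\tau$$ holds for all $\tau\in(0,1]$, then for any bounded interval $\mathcal{I}\subset[0,\infty)$ there is a constant $c^{\mathcal{I}}_1>0$ such that $$\sup_{t\in\mathcal{I}}\|F(t/n)^n-e^{-tH}\|\le c^{\mathcal{I}}_1\,\frac{1}{n}$$ holds for all integers $n\ge1$.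
   Context: $\mathcal{L}(\mathfrak{H})$ is the space of bounded linear operators on $\mathfrak{H}$, $\|\cdot\|$ is the operator norm, $\mathds{1}$ is the identity operator, and $\operatorname{s-lim}$ denotes the limit in the strong operator topology. *)

theory Defs
  imports "HOL-Analysis.Analysis"
begin

text \<open>
  Complex Hilbert spaces. The real structure is that of the class \<open>real_inner\<close>, so norm,
  topology and the type \<open>'a \<Rightarrow>\<^sub>L 'a\<close> of bounded operators (with the operator norm) are those of
  the library. The complex inner product is antilinear in its first argument.
\<close>

class complex_vector = real_vector +
  fixes scaleC :: "complex \<Rightarrow> 'a \<Rightarrow> 'a"  (infixr "*\<^sub>C" 75)
  assumes scaleC_add_right: "a *\<^sub>C (x + y) = a *\<^sub>C x + a *\<^sub>C y"
    and scaleC_add_left: "(a + b) *\<^sub>C x = a *\<^sub>C x + b *\<^sub>C x"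
    and scaleC_scaleC: "a *\<^sub>C b *\<^sub>C x = (a * b) *\<^sub>C x"
    and scaleR_scaleC: "r *\<^sub>R x = complex_of_real r *\<^sub>C x"

class complex_inner = complex_vector + real_inner +
  fixes cinner :: "'a \<Rightarrow> 'a \<Rightarrow> complex"
  assumes cinner_commute: "cinner x y = cnj (cinner y x)"
    and cinner_add_right: "cinner x (y + z) = cinner x y + cinner x z"
    and cinner_scaleC_right: "cinner x (a *\<^sub>C y) = a * cinner x y"
    and inner_eq_Re_cinner: "inner x y = Re (cinner x y)"

class chilbert_space = complex_inner + complete_space
begin
subclass banach ..
end

instantiation complex :: chilbert_space
begin
definition scaleC_complex :: "complex \<Rightarrow> complex \<Rightarrow> complex" where
  "scaleC_complex a x = a * x"
definition cinner_complex :: "complex \<Rightarrow> complex \<Rightarrow> complex" where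
  "cinner_complex x y = cnj x * y"
instance
  by standard
    (auto simp: scaleC_complex_def cinner_complex_def algebra_simps scaleR_conv_of_real
      inner_complex_def)
end

text \<open>
  A (possibly unbounded) operator is given by its domain \<open>D\<close> and a function \<open>T\<close>, of which only
  the values on \<open>D\<close> matter. Bounded operators \<open>A :: 'a \<Rightarrow>\<^sub>L 'a\<close> are a priori only real-linear;
  complex linearity is the condition \<open>is_operator UNIV (blinfun_apply A)\<close>.
\<close>

definition is_operator :: "'a::complex_vector set \<Rightarrow> ('a \<Rightarrow> 'a) \<Rightarrow> bool" where
  "is_operator D T \<longleftrightarrow>
     0 \<in> D \<and>
     (\<forall>x\<in>D. \<forall>y\<in>D. x + y \<in> D \<and> T (x + y) = T x + T y) \<and>
     (\<forall>c. \<forall>x\<in>D. c *\<^sub>C x \<in> D \<and> T (c *\<^sub>C x) = c *\<^sub>C T x)"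

definition adjoint_dom :: "'a::complex_inner set \<Rightarrow> ('a \<Rightarrow> 'a) \<Rightarrow> 'a set" where
  "adjoint_dom D T = {y. \<exists>z. \<forall>x\<in>D. cinner y (T x) = cinner z x}"

definition adjoint_op :: "'a::complex_inner set \<Rightarrow> ('a \<Rightarrow> 'a) \<Rightarrow> 'a \<Rightarrow> 'a" where
  "adjoint_op D T y = (THE z. \<forall>x\<in>D. cinner y (T x) = cinner z x)"

definition self_adjoint :: "'a::complex_inner set \<Rightarrow> ('a \<Rightarrow> 'a) \<Rightarrow> bool" where
  "self_adjoint D T \<longleftrightarrow>
     is_operator D T \<and> closure D = UNIV \<and>
     adjoint_dom D T = D \<and> (\<forall>x\<in>D. adjoint_op D T x = T x)"

definition nonneg_op :: "'a::complex_inner set \<Rightarrow> ('a \<Rightarrow> 'a) \<Rightarrow> bool" where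
  "nonneg_op D T \<longleftrightarrow> (\<forall>x\<in>D. cinner x (T x) \<in> \<real>\<^sub>\<ge>\<^sub>0)"

text \<open>
  The inverse of an operator as a bounded operator; meaningful if \<open>T\<close> maps \<open>D\<close> bijectively onto
  the whole space with bounded inverse, as \<open>1 + T\<close> does for every self-adjoint \<open>T \<ge> 0\<close>.
\<close>

definition bounded_inverse :: "'a::chilbert_space set \<Rightarrow> ('a \<Rightarrow> 'a) \<Rightarrow> 'a \<Rightarrow>\<^sub>L 'a" where
  "bounded_inverse D T = Blinfun (the_inv_into D T)"

definition blinfun_power :: "('a::real_normed_vector \<Rightarrow>\<^sub>L 'a) \<Rightarrow> nat \<Rightarrow> 'a \<Rightarrow>\<^sub>L 'a" where
  "blinfun_power A n = ((\<lambda>B. A o\<^sub>L B) ^^ n) id_blinfun"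

text \<open>Measurability in the weak sense, the weakest of the usual notions.\<close>

definition measurable_family :: "(real \<Rightarrow> 'a::complex_inner \<Rightarrow>\<^sub>L 'a) \<Rightarrow> bool" where
  "measurable_family F \<longleftrightarrow>
     (\<forall>x y. (\<lambda>t. cinner x (F t y)) \<in> borel_measurable (lebesgue_on {0..}))"

definition C0_semigroup :: "(real \<Rightarrow> 'a::chilbert_space \<Rightarrow>\<^sub>L 'a) \<Rightarrow> bool" where
  "C0_semigroup U \<longleftrightarrow>
     (\<forall>t\<ge>0. is_operator UNIV (U t)) \<and>
     U 0 = id_blinfun \<and>
     (\<forall>s\<ge>0. \<forall>t\<ge>0. U (s + t) = U s o\<^sub>L U t) \<and>
     (\<forall>x. ((\<lambda>t. U t x) \<longlongrightarrow> x) (at_right 0))"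

definition has_generator ::
  "(real \<Rightarrow> 'a::chilbert_space \<Rightarrow>\<^sub>L 'a) \<Rightarrow> 'a set \<Rightarrow> ('a \<Rightarrow> 'a) \<Rightarrow> bool" where
  "has_generator U D A \<longleftrightarrow>
     D = {x. \<exists>y. ((\<lambda>h. (U h x - x) /\<^sub>R h) \<longlongrightarrow> y) (at_right 0)} \<and>
     (\<forall>x\<in>D. ((\<lambda>h. (U h x - x) /\<^sub>R h) \<longlongrightarrow> A x) (at_right 0))"

text \<open>
  \<open>op_exp D A t\<close> is \<open>e\<^sup>t\<^sup>A\<close> for \<open>t \<ge> 0\<close>, the value at \<open>t\<close> of the strongly continuous semigroup
  generated by \<open>A\<close>. Semigroups are functions on all reals here, determined on \<open>t \<ge> 0\<close> only,
  so the description is applied to the value and not to the semigroup.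
\<close>

definition op_exp :: "'a::chilbert_space set \<Rightarrow> ('a \<Rightarrow> 'a) \<Rightarrow> real \<Rightarrow> 'a \<Rightarrow>\<^sub>L 'a" where
  "op_exp D A t = (THE B. \<exists>U. C0_semigroup U \<and> has_generator U D A \<and> B = U t)"

end

theory Submission
  imports Defs
begin

text \<open>
  Write \<open>\<tau> = t / n\<close> and \<open>G = F(\<tau>)\<close>. Then \<open>e\<^sup>-\<^sup>t\<^sup>S\<^sup>(\<^sup>\<tau>\<^sup>)\<close> is \<open>e\<^sup>-\<^sup>n\<^sup>(\<^sup>1\<^sup>-\<^sup>G\<^sup>)\<close>, and it serves as the
  intermediary between \<open>G\<^sup>n\<close> and \<open>e\<^sup>-\<^sup>t\<^sup>H\<close>.

  The distance from \<open>G\<^sup>n\<close> to \<open>e\<^sup>-\<^sup>n\<^sup>(\<^sup>1\<^sup>-\<^sup>G\<^sup>)\<close> is at most \<open>16 / n\<close> for every \<open>0 \<le> G \<le> 1\<close>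
  (\<open>norm_power_diff_poisson_op_le\<close>). Telescoping gives \<open>n\<close> terms, each containing the factor
  \<open>G - e\<^sup>-\<^sup>(\<^sup>1\<^sup>-\<^sup>G\<^sup>)\<close>, which is of second order in \<open>1 - G\<close>; the remaining \<open>n - 1\<close> factors smooth, and
  each factor \<open>1 - G\<close> is worth \<open>O(1/n)\<close>. The source of all smoothing is
  \<open>\<parallel>G\<^sup>k(1 - G)\<parallel> \<le> 1/(k + 1)\<close> (\<open>norm_power_defect_le\<close>): the non-negative operators \<open>G\<^sup>k(1 - G)\<close>
  decrease in \<open>k\<close> and their sum telescopes to at most \<open>1\<close>. Averaging over a Poisson distribution
  of \<open>k\<close> turns this into \<open>\<parallel>(1 - G)e\<^sup>-\<^sup>s\<^sup>(\<^sup>1\<^sup>-\<^sup>G\<^sup>)\<parallel> \<le> 1/s\<close>.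

  The distance from \<open>e\<^sup>-\<^sup>t\<^sup>S\<^sup>(\<^sup>\<tau>\<^sup>)\<close> to \<open>e\<^sup>-\<^sup>t\<^sup>H\<close> is at most a multiple of \<open>\<tau> / t = 1 / n\<close>, because a
  difference of resolvents controls the difference of the semigroups at time \<open>t\<close> up to a factor of
  order \<open>1/t\<close> (\<open>decaying_semigroup_compare\<close>, \<open>poisson_op_resolvent_compare\<close>). Integrating the
  derivative of \<open>e\<^sup>-\<^sup>(\<^sup>t\<^sup>-\<^sup>s\<^sup>)\<^sup>A e\<^sup>-\<^sup>s\<^sup>B\<close> directly would lose a logarithm, since the bounds \<open>1/(t - s)\<close> and
  \<open>1/s\<close> are not integrable at the ends. Splitting at \<open>t/2\<close> and integrating by parts moves the
  unbounded factors to the end that stays away from \<open>0\<close>.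

  The comparison is made between the bounded operators \<open>S(\<tau>)\<close> and \<open>S(\<sigma>)\<close>. It shows that
  \<open>e\<^sup>-\<^sup>t\<^sup>S\<^sup>(\<^sup>\<sigma>\<^sup>)\<close> is Cauchy in norm as \<open>\<sigma> \<rightarrow> 0\<close>, and its limit is the semigroup of \<open>-H\<close>. A second order Taylor bound on vectors in the range of the
  resolvent survives the limit and gives the derivative at \<open>0\<close> on the domain of \<open>H\<close>
  (\<open>heat_derivative_at_0\<close>); self-adjointness of \<open>H\<close> excludes a larger domain
  (\<open>has_generator_heat\<close>). Finally \<open>-H\<close> generates only one semigroup, since the squared norm of the
  difference of two orbits does not increase (\<open>C0_semigroup_unique_on_domain\<close>).
\<close>

section \<open>Powers of a non-negative contraction\<close>

lemmas compose_simps = bounded_bilinear.add_left[OF bounded_bilinear_blinfun_compose]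
  bounded_bilinear.add_right[OF bounded_bilinear_blinfun_compose]
  bounded_bilinear.diff_left[OF bounded_bilinear_blinfun_compose]
  bounded_bilinear.diff_right[OF bounded_bilinear_blinfun_compose]
  bounded_bilinear.scaleR_left[OF bounded_bilinear_blinfun_compose]
  bounded_bilinear.scaleR_right[OF bounded_bilinear_blinfun_compose]
  bounded_bilinear.minus_left[OF bounded_bilinear_blinfun_compose]
  bounded_bilinear.minus_right[OF bounded_bilinear_blinfun_compose]

lemma compose_assoc: "(A o\<^sub>L B) o\<^sub>L C = A o\<^sub>L (B o\<^sub>L C)"
  by (rule blinfun_eqI) simp

lemma compose_id [simp]: "id_blinfun o\<^sub>L A = A" "A o\<^sub>L id_blinfun = A"
  by (auto intro!: blinfun_eqI)

lemma norm_compose_le: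
  assumes "norm A \<le> a" "norm B \<le> b"
  shows "norm (A o\<^sub>L B) \<le> a * b"
proof -
  have "0 \<le> a" using assms(1) norm_ge_zero order_trans by blast
  then show ?thesis
    using norm_blinfun_compose[of A B] mult_mono[OF assms] by (meson norm_ge_zero order_trans)
qed

lemma blinfun_power_0 [simp]: "blinfun_power A 0 = id_blinfun"
  by (simp add: blinfun_power_def)

lemma blinfun_power_Suc [simp]: "blinfun_power A (Suc n) = A o\<^sub>L blinfun_power A n"
  by (simp add: blinfun_power_def)

lemma blinfun_power_add: "blinfun_power A (m + n) = blinfun_power A m o\<^sub>L blinfun_power A n"
  by (induction m) (simp_all add: compose_assoc)

lemma blinfun_power_commute:
  assumes "X o\<^sub>L A = A o\<^sub>L X"
  shows "X o\<^sub>L blinfun_power A n = blinfun_power A n o\<^sub>L X"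
proof (induction n)
  case (Suc n)
  have "X o\<^sub>L blinfun_power A (Suc n) = (X o\<^sub>L A) o\<^sub>L blinfun_power A n"
    by (simp add: compose_assoc)
  also have "\<dots> = A o\<^sub>L (X o\<^sub>L blinfun_power A n)" by (simp add: assms compose_assoc)
  finally show ?case by (simp add: Suc compose_assoc)
qed simp

lemma norm_blinfun_power:
  assumes "norm A \<le> 1" shows "norm (blinfun_power A n) \<le> 1"
proof (induction n)
  case (Suc n)
  then show ?case using norm_compose_le[OF assms, of "blinfun_power A n" 1] by simp
qed (simp add: norm_blinfun_id_le)

text \<open>
  Symmetry with respect to the real inner product suffices for all norm estimates.
\<close>
definition symmetric_op :: "('a::real_inner \<Rightarrow>\<^sub>L 'a) \<Rightarrow> bool" where
  "symmetric_op A \<longleftrightarrow> (\<forall>x y. inner (A x) y = inner x (A y))"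

lemma symmetric_opD: "symmetric_op A \<Longrightarrow> inner (A x) y = inner x (A y)"
  by (simp add: symmetric_op_def)

lemma symmetric_op_power:
  assumes "symmetric_op A" shows "symmetric_op (blinfun_power A n)"
proof (induction n)
  case (Suc n)
  have "A o\<^sub>L blinfun_power A n = blinfun_power A n o\<^sub>L A"
    by (rule blinfun_power_commute) simp
  then have "blinfun_power A (Suc n) y = blinfun_power A n (A y)" for y
    by (metis blinfun_apply_blinfun_compose blinfun_power_Suc)
  then show ?case using Suc assms by (simp add: symmetric_op_def)
qed (simp add: symmetric_op_def)

text \<open>
  The Cauchy-Schwarz inequality for the semi-definite form \<open>\<langle>Px, y\<rangle>\<close>, applied to \<open>x\<close> and \<open>Px\<close>,
  turns the order bound \<open>P \<le> c\<close> into a norm bound.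
\<close>
lemma norm_le_quadratic_form:
  fixes P :: "'a::real_inner \<Rightarrow>\<^sub>L 'a"
  assumes sym: "symmetric_op P" and pos: "\<And>x. 0 \<le> inner (P x) x"
    and le: "\<And>x. inner (P x) x \<le> c * inner x x" and "0 \<le> c"
  shows "norm P \<le> c"
proof (rule norm_blinfun_bound[OF \<open>0 \<le> c\<close>])
  fix x
  have cs: "(inner (P x) y)\<^sup>2 \<le> inner (P x) x * inner (P y) y" for y
  proof -
    have q: "0 \<le> inner (P x) x + 2 * s * inner (P x) y + s\<^sup>2 * inner (P y) y" for s
    proof -
      have "inner (P y) x = inner (P x) y"
        using symmetric_opD[OF sym, of y x] by (simp add: inner_commute)
      then have "inner (P (x + s *\<^sub>R y)) (x + s *\<^sub>R y)
        = inner (P x) x + 2 * s * inner (P x) y + s\<^sup>2 * inner (P y) y"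
        by (simp add: blinfun.bilinear_simps inner_simps power2_eq_square algebra_simps)
      then show ?thesis using pos[of "x + s *\<^sub>R y"] by simp
    qed
    show ?thesis
    proof (cases "inner (P y) y = 0")
      case True
      have "inner (P x) y = 0"
      proof (rule ccontr)
        assume n: "inner (P x) y \<noteq> 0"
        have "2 * (- (inner (P x) x + 1) / (2 * inner (P x) y)) * inner (P x) y
            = - (inner (P x) x + 1)" using n by (simp add: field_simps)
        then show False
          using q[of "- (inner (P x) x + 1) / (2 * inner (P x) y)"] True by simp
      qed
      then show ?thesis using True by simp
    next
      case False
      then have p: "0 < inner (P y) y" using pos[of y] by simp
      have "0 \<le> inner (P x) x - (inner (P x) y)\<^sup>2 / inner (P y) y"
        using q[of "- inner (P x) y / inner (P y) y"] p
        by (simp add: power2_eq_square field_simps)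
      then show ?thesis using p by (simp add: field_simps)
    qed
  qed
  have "((norm (P x))\<^sup>2)\<^sup>2 \<le> inner (P x) x * inner (P (P x)) (P x)"
    using cs[of "P x"] by (simp add: dot_square_norm)
  also have "\<dots> \<le> (c * inner x x) * (c * inner (P x) (P x))"
    by (rule mult_mono) (use le pos \<open>0 \<le> c\<close> in auto)
  also have "\<dots> = (c * norm x)\<^sup>2 * (norm (P x))\<^sup>2"
    by (simp add: dot_square_norm power2_eq_square)
  finally have *: "(norm (P x))\<^sup>2 * (norm (P x))\<^sup>2 \<le> (c * norm x)\<^sup>2 * (norm (P x))\<^sup>2"
    by (simp add: power2_eq_square)
  show "norm (P x) \<le> c * norm x"
  proof (cases "P x = 0")
    case True then show ?thesis using \<open>0 \<le> c\<close> by simp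
  next
    case False
    then have "(norm (P x))\<^sup>2 \<le> (c * norm x)\<^sup>2"
      by (intro mult_right_le_imp_le[OF *]) simp
    then show ?thesis using \<open>0 \<le> c\<close> by (simp add: power2_le_iff_abs_le)
  qed
qed

definition pos_contraction :: "('a::real_inner \<Rightarrow>\<^sub>L 'a) \<Rightarrow> bool" where
  "pos_contraction G \<longleftrightarrow> symmetric_op G \<and> (\<forall>x. 0 \<le> inner (G x) x) \<and> norm G \<le> 1"

lemma pos_contraction_le:
  fixes G :: "'a::real_inner \<Rightarrow>\<^sub>L 'a"
  assumes "norm G \<le> 1" shows "inner (G x) x \<le> inner x x"
proof -
  have "inner (G x) x \<le> norm (G x) * norm x" by (rule norm_cauchy_schwarz)
  also have "\<dots> \<le> norm x * norm x"
    using norm_blinfun[of G x] mult_right_mono[OF assms, of "norm x"]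
    by (intro mult_right_mono) auto
  finally show ?thesis by (simp add: dot_square_norm power2_eq_square)
qed

lemma pos_power:
  assumes G: "pos_contraction G"
  shows "0 \<le> inner (blinfun_power G k x) x"
proof -
  have s: "symmetric_op (blinfun_power G n)" for n
    using G by (simp add: pos_contraction_def symmetric_op_power)
  show ?thesis
  proof (cases "even k")
    case True
    then obtain m where "k = m + m" by (metis evenE mult_2)
    then have "inner (blinfun_power G k x) x = inner (blinfun_power G m x) (blinfun_power G m x)"
      by (simp add: blinfun_power_add symmetric_opD[OF s])
    then show ?thesis by simp
  next
    case False
    then obtain m where m: "k = m + Suc m" by (metis oddE add_Suc_right mult_2 Suc_eq_plus1)
    have "inner (blinfun_power G k x) x = inner (G (blinfun_power G m x)) (blinfun_power G m x)"
      by (simp only: m blinfun_power_add blinfun_apply_blinfun_compose symmetric_opD[OF s]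
          blinfun_power_Suc)
    then show ?thesis using G by (simp add: pos_contraction_def)
  qed
qed

text \<open>
  An even power can be moved symmetrically to both sides of \<open>1 - G\<close>. An odd power leaves
  \<open>G(1 - G)\<close>, which is a sum of two congruences of non-negative operators.
\<close>
lemma pos_power_defect:
  assumes G: "pos_contraction G"
  shows "0 \<le> inner ((blinfun_power G k o\<^sub>L (id_blinfun - G)) x) x"
proof -
  have s: "symmetric_op (blinfun_power G n)" for n
    using G by (simp add: pos_contraction_def symmetric_op_power)
  have d: "0 \<le> inner (y - G y) y" for y
    using G pos_contraction_le[of G y] by (simp add: pos_contraction_def inner_simps)
  have c: "blinfun_power G n (G y) = G (blinfun_power G n y)" for n y
    by (metis blinfun_apply_blinfun_compose blinfun_power_commute)
  show ?thesis
  proof (cases "even k")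
    case True
    then obtain m where m: "k = m + m" by (metis evenE mult_2)
    let ?y = "blinfun_power G m x"
    have "(blinfun_power G k o\<^sub>L (id_blinfun - G)) x = blinfun_power G m (?y - G ?y)"
      by (simp add: m blinfun_power_add blinfun.bilinear_simps c)
    then have "inner ((blinfun_power G k o\<^sub>L (id_blinfun - G)) x) x = inner (?y - G ?y) ?y"
      by (simp only: symmetric_opD[OF s])
    then show ?thesis using d by simp
  next
    case False
    then obtain m where m: "k = m + Suc m" by (metis oddE add_Suc_right mult_2 Suc_eq_plus1)
    let ?y = "blinfun_power G m x"
    have "inner ((blinfun_power G k o\<^sub>L (id_blinfun - G)) x) x = inner (G (?y - G ?y)) ?y"
      by (simp only: m blinfun_power_add blinfun_apply_blinfun_compose symmetric_opD[OF s]
          blinfun_power_Suc) (simp add: blinfun.bilinear_simps c inner_simps)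
    also have "\<dots> = inner (?y - G ?y) (G ?y)"
      using G by (simp add: pos_contraction_def symmetric_opD)
    \<comment> \<open>\<open>G - G\<^sup>2 = G(1 - G)G + (1 - G)G(1 - G)\<close>\<close>
    also have "\<dots> = inner (G ?y - G (G ?y)) (G ?y) + inner (G (?y - G ?y)) (?y - G ?y)"
      using G by (simp add: pos_contraction_def symmetric_opD inner_simps blinfun.bilinear_simps)
    finally show ?thesis using d[of "G ?y"] G by (simp add: pos_contraction_def)
  qed
qed

text \<open>
  The quadratic forms of \<open>G\<^sup>i(1 - G)\<close> decrease in \<open>i\<close>, so \<open>k + 1\<close> times the last one is at most
  their sum over \<open>i \<le> k\<close>, which is the form of \<open>1 - G\<^sup>k\<^sup>+\<^sup>1\<close>.
\<close>
lemma norm_power_defect_le: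
  assumes G: "pos_contraction G"
  shows "norm (blinfun_power G k o\<^sub>L (id_blinfun - G)) \<le> 1 / (real k + 1)"
proof (rule norm_le_quadratic_form)
  let ?Q = "\<lambda>k. blinfun_power G k o\<^sub>L (id_blinfun - G)"
  have s: "symmetric_op (blinfun_power G n)" for n
    using G by (simp add: pos_contraction_def symmetric_op_power)
  have c: "blinfun_power G n (G y) = G (blinfun_power G n y)" for n y
    by (metis blinfun_apply_blinfun_compose blinfun_power_commute)
  have sG: "inner (G x) y = inner x (G y)" for x y
    using G by (simp add: pos_contraction_def symmetric_opD)
  show "symmetric_op (?Q k)"
    unfolding symmetric_op_def
    by (simp add: blinfun.bilinear_simps inner_simps c symmetric_opD[OF s] sG)
  show "0 \<le> inner (?Q k x) x" for x by (rule pos_power_defect[OF G])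
  show "inner (?Q k x) x \<le> 1 / (real k + 1) * inner x x" for x
  proof -
    let ?a = "\<lambda>k. inner (?Q k x) x"
    have dec: "?a (Suc k) \<le> ?a k" for k
    proof -
      have "?a k - ?a (Suc k) = inner (blinfun_power G k (x - G x)) (x - G x)"
        by (simp add: blinfun.bilinear_simps inner_simps c symmetric_opD[OF s] sG)
      then show ?thesis using pos_power[OF G, of k "x - G x"] by simp
    qed
    have "(real k + 1) * ?a k \<le> (\<Sum>i\<le>k. ?a i)"
    proof -
      have "?a k \<le> ?a i" if "i \<le> k" for i
        using lift_Suc_antimono_le[of ?a, OF dec that] .
      then have "(\<Sum>i\<le>k. ?a k) \<le> (\<Sum>i\<le>k. ?a i)" by (intro sum_mono) auto
      then show ?thesis by (simp add: algebra_simps)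
    qed
    also have "(\<Sum>i\<le>k. ?a i) = inner x x - inner (blinfun_power G (Suc k) x) x"
      by (induction k) (simp_all add: blinfun.bilinear_simps inner_simps c)
    also have "\<dots> \<le> inner x x" using pos_power[OF G, of "Suc k" x] by linarith
    finally show ?thesis by (simp add: field_simps)
  qed
qed simp

section \<open>The semigroup generated by a contraction minus the identity\<close>

definition exp_op :: "('a::banach \<Rightarrow>\<^sub>L 'a) \<Rightarrow> real \<Rightarrow> 'a \<Rightarrow>\<^sub>L 'a" where
  "exp_op G s = (\<Sum>k. (s ^ k / fact k) *\<^sub>R blinfun_power G k)"

lemma exp_real_sums: "(\<lambda>k. s ^ k / fact k) sums exp (s::real)"
  using exp_converges[of s] by (simp add: divide_inverse mult.commute)

lemma sums_norm_le:
  fixes f :: "nat \<Rightarrow> 'b::banach"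
  assumes "\<And>k. norm (f k) \<le> g k" "g sums c"
  shows "summable f" "norm (suminf f) \<le> c"
proof -
  have g: "summable g" and c: "c = suminf g" using assms(2) by (auto simp: sums_iff)
  show "summable f" using summable_comparison_test'[OF g, of 0 f] assms(1) by simp
  show "norm (suminf f) \<le> c"
    unfolding c by (rule norm_suminf_le) (use assms g in auto)
qed

lemma exp_op_sums:
  assumes "norm G \<le> 1"
  shows "(\<lambda>k. (s ^ k / fact k) *\<^sub>R blinfun_power G k) sums exp_op G s"
proof -
  have "norm ((s ^ k / fact k) *\<^sub>R blinfun_power G k) \<le> \<bar>s\<bar> ^ k / fact k" for k
    using mult_left_mono[OF norm_blinfun_power[OF assms, of k], of "\<bar>s\<bar> ^ k / fact k"]
    by (simp add: power_abs)
  from sums_norm_le(1)[OF this exp_real_sums] show ?thesis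
    unfolding exp_op_def by (rule summable_sums)
qed

text \<open>
  The remainder satisfies a linear recursion in \<open>k\<close>, and the right-hand side satisfies the same
  recursion with \<open>\<bar>s\<bar>\<close> and \<open>\<bar>h\<bar>\<close>.
\<close>
lemma power_taylor1_le:
  fixes s h :: real
  shows "\<bar>(s + h) ^ k - s ^ k - h * (real k * s ^ (k - 1))\<bar>
     \<le> (\<bar>s\<bar> + \<bar>h\<bar>) ^ k - \<bar>s\<bar> ^ k - \<bar>h\<bar> * (real k * \<bar>s\<bar> ^ (k - 1))"
proof (induction k)
  case (Suc k)
  have rec: "(x + y) ^ Suc k - x ^ Suc k - y * (real (Suc k) * x ^ (Suc k - 1))
    = (x + y) * ((x + y) ^ k - x ^ k - y * (real k * x ^ (k - 1))) + y\<^sup>2 * (real k * x ^ (k - 1))"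
    for x y :: real
    by (cases k) (simp_all add: algebra_simps power2_eq_square)
  have "\<bar>s + h\<bar> * \<bar>(s + h) ^ k - s ^ k - h * (real k * s ^ (k - 1))\<bar>
    \<le> (\<bar>s\<bar> + \<bar>h\<bar>) * ((\<bar>s\<bar> + \<bar>h\<bar>) ^ k - \<bar>s\<bar> ^ k - \<bar>h\<bar> * (real k * \<bar>s\<bar> ^ (k - 1)))"
    by (rule mult_mono) (use Suc abs_triangle_ineq in auto)
  moreover have "\<bar>h\<^sup>2 * (real k * s ^ (k - 1))\<bar> = \<bar>h\<bar>\<^sup>2 * (real k * \<bar>s\<bar> ^ (k - 1))"
    by (simp add: abs_mult power_abs)
  moreover have "\<bar>(s + h) * ((s + h) ^ k - s ^ k - h * (real k * s ^ (k - 1)))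
      + h\<^sup>2 * (real k * s ^ (k - 1))\<bar>
    \<le> \<bar>s + h\<bar> * \<bar>(s + h) ^ k - s ^ k - h * (real k * s ^ (k - 1))\<bar>
      + \<bar>h\<^sup>2 * (real k * s ^ (k - 1))\<bar>"
    by (rule order_trans[OF abs_triangle_ineq]) (simp add: abs_mult)
  ultimately show ?case
    unfolding rec by linarith
qed simp

text \<open>
  Termwise comparison with the scalar exponential series, so differentiability of the operator
  series reduces to that of \<open>exp\<close>.
\<close>
lemma exp_op_taylor1:
  fixes G :: "'a::banach \<Rightarrow>\<^sub>L 'a"
  assumes G: "norm G \<le> 1"
  shows "norm (exp_op G (s + h) - exp_op G s - h *\<^sub>R (G o\<^sub>L exp_op G s))
     \<le> exp (\<bar>s\<bar> + \<bar>h\<bar>) - exp \<bar>s\<bar> - \<bar>h\<bar> * exp \<bar>s\<bar>"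
proof -
  have shift: "(\<lambda>k. (real k * s ^ (k - 1) / fact k) *\<^sub>R blinfun_power G k) sums (G o\<^sub>L exp_op G s)"
  proof -
    have "(\<lambda>k. G o\<^sub>L ((s ^ k / fact k) *\<^sub>R blinfun_power G k)) sums (G o\<^sub>L exp_op G s)"
      by (rule bounded_linear.sums[OF bounded_bilinear.bounded_linear_right
            [OF bounded_bilinear_blinfun_compose] exp_op_sums[OF G]])
    moreover have "G o\<^sub>L ((s ^ k / fact k) *\<^sub>R blinfun_power G k)
       = (real (Suc k) * s ^ (Suc k - 1) / fact (Suc k)) *\<^sub>R blinfun_power G (Suc k)" for k
      by (simp add: compose_simps del: of_nat_Suc)
    ultimately have "(\<lambda>k. (real (Suc k) * s ^ (Suc k - 1) / fact (Suc k)) *\<^sub>R blinfun_power G (Suc k))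
        sums (G o\<^sub>L exp_op G s)" by simp
    then show ?thesis
      by (subst (asm) sums_Suc_iff) simp
  qed
  have rshift: "(\<lambda>k. real k * s ^ (k - 1) / fact k) sums exp s" for s :: real
  proof -
    have "(\<lambda>k. real (Suc k) * s ^ (Suc k - 1) / fact (Suc k)) sums exp s"
      using exp_real_sums[of s] by (simp del: of_nat_Suc)
    then show ?thesis by (subst (asm) sums_Suc_iff) simp
  qed
  let ?f = "\<lambda>k. ((s + h) ^ k / fact k) *\<^sub>R blinfun_power G k - (s ^ k / fact k) *\<^sub>R blinfun_power G k
     - h *\<^sub>R ((real k * s ^ (k - 1) / fact k) *\<^sub>R blinfun_power G k)"
  let ?g = "\<lambda>k. (\<bar>s\<bar> + \<bar>h\<bar>) ^ k / fact k - \<bar>s\<bar> ^ k / fact k - \<bar>h\<bar> * (real k * \<bar>s\<bar> ^ (k - 1) / fact k)"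
  have f: "?f sums (exp_op G (s + h) - exp_op G s - h *\<^sub>R (G o\<^sub>L exp_op G s))"
    by (intro sums_diff exp_op_sums[OF G] sums_scaleR_right shift)
  have g: "?g sums (exp (\<bar>s\<bar> + \<bar>h\<bar>) - exp \<bar>s\<bar> - \<bar>h\<bar> * exp \<bar>s\<bar>)"
    by (intro sums_diff sums_mult exp_real_sums rshift)
  have "norm (?f k) \<le> ?g k" for k
  proof -
    have "?f k = (((s + h) ^ k - s ^ k - h * (real k * s ^ (k - 1))) / fact k) *\<^sub>R blinfun_power G k"
      by (simp add: scaleR_diff_left diff_divide_distrib)
    then have "norm (?f k) = \<bar>(s + h) ^ k - s ^ k - h * (real k * s ^ (k - 1))\<bar> / fact k
        * norm (blinfun_power G k)" by simp
    also have "\<dots> \<le> ((\<bar>s\<bar> + \<bar>h\<bar>) ^ k - \<bar>s\<bar> ^ k - \<bar>h\<bar> * (real k * \<bar>s\<bar> ^ (k - 1))) / fact k * 1"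
      by (rule mult_mono, rule divide_right_mono[OF power_taylor1_le], simp,
          rule norm_blinfun_power[OF G])
        (rule divide_nonneg_nonneg, rule order_trans[OF abs_ge_zero power_taylor1_le], auto)
    also have "\<dots> = ?g k" by (simp add: diff_divide_distrib)
    finally show ?thesis .
  qed
  from sums_norm_le(2)[OF this g] show ?thesis using f by (simp add: sums_iff)
qed

lemma exp_op_deriv:
  fixes G :: "'a::banach \<Rightarrow>\<^sub>L 'a"
  assumes G: "norm G \<le> 1"
  shows "(exp_op G has_vector_derivative (G o\<^sub>L exp_op G s)) (at s)"
proof -
  have "((\<lambda>h. (exp (\<bar>s\<bar> + \<bar>h\<bar>) - exp \<bar>s\<bar> - \<bar>h\<bar> * exp \<bar>s\<bar>) / \<bar>h\<bar>) \<longlongrightarrow> 0) (at 0)"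
  proof -
    have "((\<lambda>h. (exp (\<bar>s\<bar> + h) - exp \<bar>s\<bar>) / h) \<longlongrightarrow> exp \<bar>s\<bar>) (at 0)"
      using DERIV_exp[of "\<bar>s\<bar>"] unfolding DERIV_def .
    moreover have "filterlim (\<lambda>h::real. \<bar>h\<bar>) (at 0) (at 0)"
      unfolding filterlim_at using tendsto_rabs_zero[OF tendsto_ident_at]
      by (auto simp: eventually_at_filter)
    ultimately have "((\<lambda>h. (exp (\<bar>s\<bar> + \<bar>h\<bar>) - exp \<bar>s\<bar>) / \<bar>h\<bar> - exp \<bar>s\<bar>) \<longlongrightarrow> exp \<bar>s\<bar> - exp \<bar>s\<bar>) (at 0)"
      by (intro tendsto_intros) (rule filterlim_compose)
    moreover have "\<forall>\<^sub>F h in at 0. (exp (\<bar>s\<bar> + \<bar>h\<bar>) - exp \<bar>s\<bar>) / \<bar>h\<bar> - exp \<bar>s\<bar>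
        = (exp (\<bar>s\<bar> + \<bar>h\<bar>) - exp \<bar>s\<bar> - \<bar>h\<bar> * exp \<bar>s\<bar>) / \<bar>h\<bar>"
      by (auto simp: eventually_at_filter diff_divide_distrib)
    ultimately show ?thesis using Lim_transform_eventually by fastforce
  qed
  then have "((\<lambda>h. norm (exp_op G (s + h) - exp_op G s - h *\<^sub>R (G o\<^sub>L exp_op G s)) / norm h) \<longlongrightarrow> 0) (at 0)"
    by (rule tendsto_sandwich[OF _ _ tendsto_const, rotated 2])
      (auto intro!: always_eventually divide_right_mono exp_op_taylor1[OF G])
  then show ?thesis
    unfolding has_vector_derivative_def has_derivative_at
    by (auto intro!: bounded_linear_scaleR_left)
qed

text \<open>
  This is \<open>e\<^sup>-\<^sup>s\<^sup>(\<^sup>1\<^sup>-\<^sup>G\<^sup>)\<close>, written as the mean of \<open>G\<^sup>k\<close> over a Poisson distribution of \<open>k\<close> with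
  parameter \<open>s\<close>. Bounds for the powers of \<open>G\<close> can therefore be averaged.
\<close>
definition poisson_op :: "('a::banach \<Rightarrow>\<^sub>L 'a) \<Rightarrow> real \<Rightarrow> 'a \<Rightarrow>\<^sub>L 'a" where
  "poisson_op G s = exp (- s) *\<^sub>R exp_op G s"

lemma poisson_op_0 [simp]: "poisson_op G 0 = id_blinfun"
proof -
  have "(\<Sum>k. ((0::real) ^ k / fact k) *\<^sub>R blinfun_power G k)
      = (\<Sum>k\<in>{0}. ((0::real) ^ k / fact k) *\<^sub>R blinfun_power G k)"
    by (rule suminf_finite) auto
  then show ?thesis by (simp add: poisson_op_def exp_op_def)
qed

lemma poisson_op_deriv:
  fixes G :: "'a::banach \<Rightarrow>\<^sub>L 'a"
  assumes "norm G \<le> 1"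
  shows "(poisson_op G has_vector_derivative - ((id_blinfun - G) o\<^sub>L poisson_op G s)) (at s within A)"
proof -
  have "((\<lambda>s. exp (- s) *\<^sub>R exp_op G s) has_vector_derivative
     (exp (- s) *\<^sub>R (G o\<^sub>L exp_op G s) + (- exp (- s)) *\<^sub>R exp_op G s)) (at s)"
    by (intro has_vector_derivative_scaleR exp_op_deriv assms) (auto intro!: derivative_eq_intros)
  then have "(poisson_op G has_vector_derivative - ((id_blinfun - G) o\<^sub>L poisson_op G s)) (at s)"
    by (simp add: poisson_op_def[abs_def] compose_simps scaleR_diff_right)
  then show ?thesis by (rule has_vector_derivative_at_within)
qed

lemma poisson_op_sums:
  fixes G :: "'a::banach \<Rightarrow>\<^sub>L 'a"
  assumes "norm G \<le> 1"
  shows "(\<lambda>k. (exp (- s) * (s ^ k / fact k)) *\<^sub>R blinfun_power G k) sums poisson_op G s"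
  using sums_scaleR_right[OF exp_op_sums[OF assms, of s], of "exp (-s)"]
  by (simp add: poisson_op_def)

text \<open>
  Besides the algebra of commuting operators, this yields complex linearity: a real-linear operator
  is complex linear iff it commutes with all multiplications by complex scalars.
\<close>
lemma poisson_op_commute:
  fixes G :: "'a::banach \<Rightarrow>\<^sub>L 'a"
  assumes G: "norm G \<le> 1" and X: "X o\<^sub>L G = G o\<^sub>L X"
  shows "X o\<^sub>L poisson_op G s = poisson_op G s o\<^sub>L X"
proof -
  let ?c = "\<lambda>k. exp (- s) * (s ^ k / fact k)"
  have "(\<lambda>k. X o\<^sub>L (?c k *\<^sub>R blinfun_power G k)) sums (X o\<^sub>L poisson_op G s)"
    by (rule bounded_linear.sums[OF bounded_bilinear.bounded_linear_right
          [OF bounded_bilinear_blinfun_compose] poisson_op_sums[OF G]])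
  moreover have "(\<lambda>k. (?c k *\<^sub>R blinfun_power G k) o\<^sub>L X) sums (poisson_op G s o\<^sub>L X)"
    by (rule bounded_linear.sums[OF bounded_bilinear.bounded_linear_left
          [OF bounded_bilinear_blinfun_compose] poisson_op_sums[OF G]])
  moreover have "X o\<^sub>L (?c k *\<^sub>R blinfun_power G k) = (?c k *\<^sub>R blinfun_power G k) o\<^sub>L X" for k
    by (simp add: compose_simps blinfun_power_commute[OF X])
  ultimately show ?thesis using sums_unique2 by fastforce
qed

lemma norm_compose_poisson_op:
  fixes G X :: "'a::banach \<Rightarrow>\<^sub>L 'a"
  assumes G: "norm G \<le> 1" and b: "\<And>k. norm (X o\<^sub>L blinfun_power G k) \<le> b k"
    and s: "0 \<le> s" and c: "(\<lambda>k. exp (- s) * (s ^ k / fact k) * b k) sums c"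
  shows "norm (X o\<^sub>L poisson_op G s) \<le> c"
proof -
  have "(\<lambda>k. X o\<^sub>L ((exp (- s) * (s ^ k / fact k)) *\<^sub>R blinfun_power G k)) sums (X o\<^sub>L poisson_op G s)"
    by (rule bounded_linear.sums[OF bounded_bilinear.bounded_linear_right
          [OF bounded_bilinear_blinfun_compose] poisson_op_sums[OF G]])
  then have *: "X o\<^sub>L poisson_op G s = (\<Sum>k. X o\<^sub>L ((exp (- s) * (s ^ k / fact k)) *\<^sub>R blinfun_power G k))"
    by (rule sums_unique)
  show ?thesis
    unfolding *
  proof (rule sums_norm_le(2)[OF _ c])
    fix k
    have "norm (X o\<^sub>L ((exp (- s) * (s ^ k / fact k)) *\<^sub>R blinfun_power G k))
        = exp (- s) * (s ^ k / fact k) * norm (X o\<^sub>L blinfun_power G k)"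
      using s by (simp add: compose_simps)
    also have "\<dots> \<le> exp (- s) * (s ^ k / fact k) * b k"
      using s b by (intro mult_left_mono) auto
    finally show "norm (X o\<^sub>L ((exp (- s) * (s ^ k / fact k)) *\<^sub>R blinfun_power G k))
        \<le> exp (- s) * (s ^ k / fact k) * b k" .
  qed
qed

lemma norm_poisson_op_le:
  fixes G :: "'a::banach \<Rightarrow>\<^sub>L 'a"
  assumes G: "norm G \<le> 1" and s: "0 \<le> s"
  shows "norm (poisson_op G s) \<le> 1"
proof -
  have "(\<lambda>k. exp (- s) * (s ^ k / fact k) * 1) sums 1"
    using sums_mult[OF exp_real_sums[of s], of "exp (-s)"] by (simp add: mult_exp_exp)
  from norm_compose_poisson_op[OF G _ s this, of id_blinfun] show ?thesis
    using norm_blinfun_power[OF G] by simp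
qed

lemma constant_if_zero_derivative:
  fixes f :: "real \<Rightarrow> 'b::real_normed_vector"
  assumes "\<And>s. (f has_vector_derivative 0) (at s)"
  shows "f a = f b"
  using has_derivative_zero_unique[of UNIV f b a] assms
  by (auto simp: has_vector_derivative_def)

text \<open>
  The product of the values at \<open>r\<close> and \<open>s + t - r\<close> does not depend on \<open>r\<close>.
\<close>
lemma poisson_op_add:
  fixes G :: "'a::banach \<Rightarrow>\<^sub>L 'a"
  assumes G: "norm G \<le> 1"
  shows "poisson_op G (s + t) = poisson_op G s o\<^sub>L poisson_op G t"
proof -
  have c: "G o\<^sub>L poisson_op G r = poisson_op G r o\<^sub>L G" for r
    by (rule poisson_op_commute[OF G]) simp
  have "((\<lambda>r. poisson_op G r o\<^sub>L poisson_op G (s + t - r)) has_vector_derivative 0) (at r)" for r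
  proof -
    have "((\<lambda>r. poisson_op G (s + t - r)) has_vector_derivative
        ((-1) *\<^sub>R - ((id_blinfun - G) o\<^sub>L poisson_op G (s + t - r)))) (at r)"
      by (rule vector_diff_chain_at[unfolded o_def, OF _ poisson_op_deriv[OF G]])
        (auto intro!: derivative_eq_intros)
    from bounded_bilinear.has_vector_derivative[OF bounded_bilinear_blinfun_compose
        poisson_op_deriv[OF G] this]
    moreover have "G o\<^sub>L (poisson_op G r o\<^sub>L poisson_op G (s + t - r))
        = poisson_op G r o\<^sub>L (G o\<^sub>L poisson_op G (s + t - r))"
      by (simp only: compose_assoc[symmetric] c[of r])
    ultimately show ?thesis by (simp add: compose_assoc compose_simps)
  qed
  from constant_if_zero_derivative[OF this, of "s" 0] show ?thesis by simp
qed

lemma symmetric_poisson_op: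
  fixes G :: "'a::{real_inner, banach} \<Rightarrow>\<^sub>L 'a"
  assumes G: "norm G \<le> 1" and sym: "symmetric_op G"
  shows "symmetric_op (poisson_op G s)"
  unfolding symmetric_op_def
proof (intro allI)
  fix x y
  let ?c = "\<lambda>k. exp (- s) * (s ^ k / fact k)"
  have *: "(\<lambda>k. (?c k *\<^sub>R blinfun_power G k) z) sums (poisson_op G s z)" for z
    by (rule bounded_linear.sums[OF blinfun.bounded_linear_left poisson_op_sums[OF G]])
  have "(\<lambda>k. inner ((?c k *\<^sub>R blinfun_power G k) x) y) sums inner (poisson_op G s x) y"
    by (rule bounded_linear.sums[OF bounded_linear_inner_left *])
  moreover have "(\<lambda>k. inner x ((?c k *\<^sub>R blinfun_power G k) y)) sums inner x (poisson_op G s y)"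
    by (rule bounded_linear.sums[OF bounded_linear_inner_right *])
  moreover have "inner ((?c k *\<^sub>R blinfun_power G k) x) y = inner x ((?c k *\<^sub>R blinfun_power G k) y)" for k
    using symmetric_opD[OF symmetric_op_power[OF sym]] by (simp add: blinfun.bilinear_simps)
  ultimately show "inner (poisson_op G s x) y = inner x (poisson_op G s y)"
    using sums_unique2 by fastforce
qed

text \<open>
  The Poisson mean of \<open>1/(k + 1)\<close> is \<open>(1 - e\<^sup>-\<^sup>s)/s\<close>.
\<close>
lemma norm_poisson_op_defect_le:
  fixes G :: "'a::{real_inner, banach} \<Rightarrow>\<^sub>L 'a"
  assumes G: "pos_contraction G" and s: "0 < s"
  shows "norm ((id_blinfun - G) o\<^sub>L poisson_op G s) \<le> 1 / s"
proof -
  have n: "norm G \<le> 1" using G by (simp add: pos_contraction_def)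
  have "(\<lambda>k. s ^ Suc k / fact (Suc k)) sums (exp s - 1)"
    using exp_real_sums[of s] by (subst sums_Suc_iff) simp
  from sums_mult[OF this, of "exp (-s) / s"]
  have "(\<lambda>k. exp (- s) * (s ^ k / fact k) * (1 / (real k + 1))) sums (exp (- s) / s * (exp s - 1))"
    using s by (simp add: field_simps)
  from norm_compose_poisson_op[OF n _ _ this, of "id_blinfun - G"]
  have "norm ((id_blinfun - G) o\<^sub>L poisson_op G s) \<le> exp (- s) / s * (exp s - 1)"
    using s norm_power_defect_le[OF G]
    by (simp add: blinfun_power_commute[of G G, OF refl] compose_simps)
  also have "\<dots> = (1 - exp (- s)) / s" by (simp add: field_simps exp_minus)
  also have "\<dots> \<le> 1 / s" using s by (simp add: divide_right_mono)
  finally show ?thesis .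
qed

section \<open>Powers against the semigroup of the same contraction\<close>

lemma norm_diff_le_of_derivative:
  fixes f :: "real \<Rightarrow> 'b::real_normed_vector"
  assumes "a \<le> b" and d: "\<And>s. s \<in> {a..b} \<Longrightarrow> (f has_vector_derivative f' s) (at s within {a..b})"
    and B: "\<And>s. s \<in> {a..b} \<Longrightarrow> norm (f' s) \<le> B"
  shows "norm (f b - f a) \<le> B * (b - a)"
proof -
  have "norm (f b - f a) \<le> B * norm (b - a)"
  proof (rule differentiable_bound[of "{a..b}" f "\<lambda>s h. h *\<^sub>R f' s"])
    show "onorm (\<lambda>h. h *\<^sub>R f' s) \<le> B" if "s \<in> {a..b}" for s
    proof (rule onorm_le)
      fix h :: real
      have "\<bar>h\<bar> * norm (f' s) \<le> \<bar>h\<bar> * B" by (intro mult_left_mono B that) auto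
      then show "norm (h *\<^sub>R f' s) \<le> B * norm h" by (simp add: mult.commute)
    qed
  qed (use assms d in \<open>auto simp: has_vector_derivative_def\<close>)
  then show ?thesis using assms(1) by simp
qed

lemma compose_left_has_vector_derivative:
  fixes L :: "'a::banach \<Rightarrow>\<^sub>L 'a"
  assumes "(f has_vector_derivative f') (at s within A)"
  shows "((\<lambda>s. L o\<^sub>L f s) has_vector_derivative L o\<^sub>L f') (at s within A)"
  by (rule bounded_linear.has_vector_derivative[OF bounded_bilinear.bounded_linear_right
        [OF bounded_bilinear_blinfun_compose] assms])

text \<open>
  The factor \<open>L\<close> is kept inside the norm here and below, because in the telescoping sum it carries
  the smoothing: \<open>\<parallel>L(1 - G)\<parallel>\<close> is far smaller than \<open>\<parallel>L\<parallel> \<parallel>1 - G\<parallel>\<close>.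
\<close>
lemma norm_compose_id_diff_poisson_op:
  fixes L G :: "'a::banach \<Rightarrow>\<^sub>L 'a"
  assumes G: "norm G \<le> 1" and s: "0 \<le> s"
  shows "norm (L o\<^sub>L (id_blinfun - poisson_op G s)) \<le> s * norm (L o\<^sub>L (id_blinfun - G))"
proof -
  have "norm ((L o\<^sub>L poisson_op G s) - (L o\<^sub>L poisson_op G 0)) \<le> norm (L o\<^sub>L (id_blinfun - G)) * (s - 0)"
  proof (rule norm_diff_le_of_derivative[OF s, where f = "\<lambda>s. L o\<^sub>L poisson_op G s"])
    fix r assume r: "r \<in> {0..s}"
    show "((\<lambda>s. L o\<^sub>L poisson_op G s) has_vector_derivative
        L o\<^sub>L - ((id_blinfun - G) o\<^sub>L poisson_op G r)) (at r within {0..s})"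
      by (rule compose_left_has_vector_derivative[OF poisson_op_deriv[OF G]])
    have "norm ((L o\<^sub>L (id_blinfun - G)) o\<^sub>L poisson_op G r) \<le> norm (L o\<^sub>L (id_blinfun - G)) * 1"
      by (rule norm_compose_le) (use norm_poisson_op_le[OF G] r in auto)
    then show "norm (L o\<^sub>L - ((id_blinfun - G) o\<^sub>L poisson_op G r)) \<le> norm (L o\<^sub>L (id_blinfun - G))"
      by (simp add: compose_simps compose_assoc norm_minus_commute)
  qed
  then show ?thesis by (simp add: compose_simps norm_minus_commute mult.commute)
qed

lemma norm_compose_poisson_op_taylor1:
  fixes L G :: "'a::banach \<Rightarrow>\<^sub>L 'a"
  assumes G: "norm G \<le> 1" and s: "0 \<le> s"
  shows "norm (L o\<^sub>L (poisson_op G s - id_blinfun + s *\<^sub>R (id_blinfun - G)))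
    \<le> s\<^sup>2 * norm (L o\<^sub>L ((id_blinfun - G) o\<^sub>L (id_blinfun - G)))"
proof -
  let ?N = "id_blinfun - G" and ?f = "\<lambda>s. L o\<^sub>L (poisson_op G s - id_blinfun + s *\<^sub>R (id_blinfun - G))"
  have "norm (?f s - ?f 0) \<le> (s * norm (L o\<^sub>L (?N o\<^sub>L ?N))) * (s - 0)"
  proof (rule norm_diff_le_of_derivative[OF s, where f = ?f])
    fix r assume r: "r \<in> {0..s}"
    show "(?f has_vector_derivative L o\<^sub>L (?N o\<^sub>L (id_blinfun - poisson_op G r))) (at r within {0..s})"
    proof (rule compose_left_has_vector_derivative)
      have "((\<lambda>s. poisson_op G s - id_blinfun + s *\<^sub>R ?N) has_vector_derivative
         (- (?N o\<^sub>L poisson_op G r) - 0 + 1 *\<^sub>R ?N)) (at r within {0..s})"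
        by (intro has_vector_derivative_add has_vector_derivative_diff poisson_op_deriv[OF G]
            has_vector_derivative_const) (auto intro!: derivative_eq_intros)
      then show "((\<lambda>s. poisson_op G s - id_blinfun + s *\<^sub>R ?N) has_vector_derivative
         ?N o\<^sub>L (id_blinfun - poisson_op G r)) (at r within {0..s})"
        by (simp add: compose_simps algebra_simps)
    qed
    have "norm ((L o\<^sub>L ?N) o\<^sub>L (id_blinfun - poisson_op G r)) \<le> r * norm ((L o\<^sub>L ?N) o\<^sub>L ?N)"
      using norm_compose_id_diff_poisson_op[OF G] r by auto
    also have "\<dots> \<le> s * norm ((L o\<^sub>L ?N) o\<^sub>L ?N)"
      using r by (intro mult_right_mono) auto
    finally show "norm (L o\<^sub>L (?N o\<^sub>L (id_blinfun - poisson_op G r))) \<le> s * norm (L o\<^sub>L (?N o\<^sub>L ?N))"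
      by (simp only: compose_assoc)
  qed
  then show ?thesis by (simp add: compose_simps power2_eq_square ac_simps)
qed

text \<open>
  Either the power or the semigroup carries at least half of the total time \<open>j + 1 + s\<close>, and its
  smoothing alone suffices.
\<close>
lemma norm_power_poisson_defect_le:
  fixes G :: "'a::{real_inner, banach} \<Rightarrow>\<^sub>L 'a"
  assumes G: "pos_contraction G" and s: "0 \<le> s"
  shows "norm (blinfun_power G j o\<^sub>L (id_blinfun - G) o\<^sub>L poisson_op G s) \<le> 2 / (real j + 1 + s)"
proof -
  let ?N = "id_blinfun - G"
  have n: "norm G \<le> 1" using G by (simp add: pos_contraction_def)
  show ?thesis
  proof (cases "s \<le> real j + 1")
    case True
    have "norm (blinfun_power G j o\<^sub>L ?N o\<^sub>L poisson_op G s) \<le> (1 / (real j + 1)) * 1"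
      by (intro norm_compose_le norm_power_defect_le G norm_poisson_op_le n s)
    also have "\<dots> \<le> 2 / (real j + 1 + s)" using True s by (simp add: field_simps)
    finally show ?thesis .
  next
    case False
    then have "0 < s" by linarith
    have "norm (blinfun_power G j o\<^sub>L (?N o\<^sub>L poisson_op G s)) \<le> 1 * (1 / s)"
      by (intro norm_compose_le norm_blinfun_power norm_poisson_op_defect_le G n \<open>0 < s\<close>)
    also have "\<dots> \<le> 2 / (real j + 1 + s)" using False \<open>0 < s\<close> by (simp add: field_simps)
    finally show ?thesis by (simp only: compose_assoc)
  qed
qed

text \<open>
  Half of the power and half of the semigroup time go to each factor \<open>1 - G\<close>.
\<close>
lemma norm_power_poisson_defect_square_le:
  fixes G :: "'a::{real_inner, banach} \<Rightarrow>\<^sub>L 'a"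
  assumes G: "pos_contraction G" and s: "0 \<le> s"
  shows "norm (blinfun_power G j o\<^sub>L poisson_op G s o\<^sub>L ((id_blinfun - G) o\<^sub>L (id_blinfun - G)))
    \<le> (4 / (real j + 1 + s))\<^sup>2"
proof -
  let ?N = "id_blinfun - G" and ?P = "poisson_op G (s / 2)"
  have n: "norm G \<le> 1" using G by (simp add: pos_contraction_def)
  define j1 where "j1 = j div 2"
  define j2 where "j2 = j - j div 2"
  have "j = j1 + j2" by (simp add: j1_def j2_def)
  have jr: "real j \<le> 2 * real j1 + 1" "real j \<le> 2 * real j2 + 1"
    unfolding j1_def j2_def by linarith+
  have c1: "?N o\<^sub>L ?P = ?P o\<^sub>L ?N"
    by (rule poisson_op_commute[OF n]) (simp add: compose_simps)
  have c2: "?P o\<^sub>L blinfun_power G i = blinfun_power G i o\<^sub>L ?P" for i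
    by (rule poisson_op_commute[OF n, symmetric]) (rule blinfun_power_commute[OF refl, symmetric])
  have c3: "?N o\<^sub>L blinfun_power G i = blinfun_power G i o\<^sub>L ?N" for i
    by (rule blinfun_power_commute) (simp add: compose_simps)
  have "poisson_op G s = ?P o\<^sub>L ?P" using poisson_op_add[OF n, of "s/2" "s/2"] by simp
  then have "blinfun_power G j o\<^sub>L poisson_op G s o\<^sub>L (?N o\<^sub>L ?N)
      = blinfun_power G j1 o\<^sub>L (blinfun_power G j2 o\<^sub>L (?P o\<^sub>L (?P o\<^sub>L (?N o\<^sub>L ?N))))"
    by (simp add: \<open>j = j1 + j2\<close> blinfun_power_add compose_assoc)
  also have "\<dots> = (blinfun_power G j1 o\<^sub>L ?N o\<^sub>L ?P) o\<^sub>L (blinfun_power G j2 o\<^sub>L ?N o\<^sub>L ?P)"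
  proof -
    have "?N (?P x) = ?P (?N x)" "?P (blinfun_power G i x) = blinfun_power G i (?P x)"
      "?N (blinfun_power G i x) = blinfun_power G i (?N x)" for i x
      using c1 c2[of i] c3[of i] by (simp_all only: blinfun_apply_blinfun_compose[symmetric])
    then show ?thesis
      by (intro blinfun_eqI) (simp only: blinfun_apply_blinfun_compose)
  qed
  finally have eq: "blinfun_power G j o\<^sub>L poisson_op G s o\<^sub>L (?N o\<^sub>L ?N)
      = (blinfun_power G j1 o\<^sub>L ?N o\<^sub>L ?P) o\<^sub>L (blinfun_power G j2 o\<^sub>L ?N o\<^sub>L ?P)" .
  have b: "2 / (real i + 1 + s / 2) \<le> 4 / (real j + 1 + s)" if "real j \<le> 2 * real i + 1" for i
  proof -
    have "2 / (real i + 1 + s / 2) = 4 / (2 * real i + 2 + s)" using s by (simp add: field_simps)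
    also have "\<dots> \<le> 4 / (real j + 1 + s)" using that s by (intro divide_left_mono) auto
    finally show ?thesis .
  qed
  have "norm (blinfun_power G i o\<^sub>L ?N o\<^sub>L ?P) \<le> 4 / (real j + 1 + s)"
    if "real j \<le> 2 * real i + 1" for i
    using norm_power_poisson_defect_le[OF G, of "s/2" i] s b[OF that] by simp
  from norm_compose_le[OF this[OF jr(1)] this[OF jr(2)]] show ?thesis
    unfolding eq by (simp add: power2_eq_square)
qed

text \<open>
  Consecutive terms of \<open>G\<^sup>n\<^sup>-\<^sup>k e\<^sup>-\<^sup>k\<^sup>(\<^sup>1\<^sup>-\<^sup>G\<^sup>)\<close> differ by \<open>G\<^sup>j e\<^sup>-\<^sup>k\<^sup>(\<^sup>1\<^sup>-\<^sup>G\<^sup>)\<close>, with \<open>j + k = n - 1\<close>, times a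
  factor of second order in \<open>1 - G\<close>, hence by at most \<open>(4/n)\<^sup>2\<close>.
\<close>
theorem norm_power_diff_poisson_op_le:
  fixes G :: "'a::{real_inner, banach} \<Rightarrow>\<^sub>L 'a"
  assumes G: "pos_contraction G" and "n \<ge> 1"
  shows "norm (blinfun_power G n - poisson_op G (real n)) \<le> 16 / real n"
proof -
  let ?N = "id_blinfun - G" and ?X = "\<lambda>k. blinfun_power G (n - k) o\<^sub>L poisson_op G (real k)"
  have nG: "norm G \<le> 1" using G by (simp add: pos_contraction_def)
  have "norm (?X k - ?X (Suc k)) \<le> (4 / real n)\<^sup>2" if kn: "k < n" for k
  proof -
    obtain j where n: "n = Suc (k + j)" using less_imp_Suc_add[OF kn] by blast
    have j: "n - k = Suc j" and jk': "n - Suc k = j" and jk: "real j + 1 + real k = real n"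
      by (simp_all add: n)
    let ?L = "blinfun_power G j o\<^sub>L poisson_op G (real k)"
    have c: "G o\<^sub>L poisson_op G r = poisson_op G r o\<^sub>L G" for r
      by (rule poisson_op_commute[OF nG]) simp
    have p: "poisson_op G (real (Suc k)) = poisson_op G (real k) o\<^sub>L poisson_op G 1"
      by (simp add: poisson_op_add[OF nG, symmetric] add.commute)
    have "poisson_op G r (G x) = G (poisson_op G r x)"
      "blinfun_power G j (G x) = G (blinfun_power G j x)" for r x
      using c[of r] blinfun_power_commute[of G G j, OF refl]
      by (simp_all only: blinfun_apply_blinfun_compose[symmetric])
    then have "?X k = ?L o\<^sub>L G"
      unfolding j blinfun_power_Suc by (intro blinfun_eqI) (simp only: blinfun_apply_blinfun_compose)
    moreover have "?X (Suc k) = ?L o\<^sub>L poisson_op G 1"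
      unfolding jk' p by (simp only: compose_assoc)
    ultimately have "?X k - ?X (Suc k) = - (?L o\<^sub>L (poisson_op G 1 - id_blinfun + 1 *\<^sub>R ?N))"
      by (simp only: compose_simps) simp
    then have "norm (?X k - ?X (Suc k)) \<le> 1\<^sup>2 * norm (?L o\<^sub>L (?N o\<^sub>L ?N))"
      using norm_compose_poisson_op_taylor1[OF nG, of 1 ?L] by simp
    also have "\<dots> \<le> 1\<^sup>2 * (4 / real n)\<^sup>2"
      using norm_power_poisson_defect_square_le[OF G, of "real k" j] unfolding jk by simp
    finally show ?thesis by simp
  qed
  then have "norm (\<Sum>k<n. ?X k - ?X (Suc k)) \<le> (\<Sum>k<n. (4 / real n)\<^sup>2)"
    by (intro sum_norm_le) auto
  moreover have "(\<Sum>k<n. ?X k - ?X (Suc k)) = ?X 0 - ?X n"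
    by (rule sum_lessThan_telescope')
  ultimately show ?thesis
    using assms(2) by (simp add: power2_eq_square)
qed

section \<open>From resolvents to semigroups\<close>

text \<open>
  \<open>W(t) = e\<^sup>-\<^sup>t\<^sup>A\<close> for a boundedly invertible \<open>A\<close> with inverse \<open>R\<close>. In the application
  \<open>A = 1 + S(\<tau>)\<close>, so that the resolvents to be compared are the inverses themselves.
\<close>
locale decaying_semigroup =
  fixes A R :: "'a::banach \<Rightarrow>\<^sub>L 'a" and W :: "real \<Rightarrow> 'a \<Rightarrow>\<^sub>L 'a"
  assumes right_inverse: "A o\<^sub>L R = id_blinfun" and left_inverse: "R o\<^sub>L A = id_blinfun"
    and commute: "A o\<^sub>L W t = W t o\<^sub>L A"
    and deriv: "(W has_vector_derivative - (A o\<^sub>L W t)) (at t)"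
    and zero: "W 0 = id_blinfun" and add: "W (s + t) = W s o\<^sub>L W t"
    and norm_le: "0 \<le> t \<Longrightarrow> norm (W t) \<le> 1"
    and decay: "0 < t \<Longrightarrow> norm (A o\<^sub>L W t) \<le> 1 / t"
begin

lemma decay_square:
  assumes "0 < t" shows "norm (A o\<^sub>L (A o\<^sub>L W t)) \<le> 4 / t\<^sup>2"
proof -
  have "A (W (t/2) x) = W (t/2) (A x)" for x
    using commute[of "t/2"] by (simp only: blinfun_apply_blinfun_compose[symmetric])
  moreover have "W t x = W (t/2) (W (t/2) x)" for x using add[of "t/2" "t/2"] by simp
  ultimately have "A o\<^sub>L (A o\<^sub>L W t) = (A o\<^sub>L W (t/2)) o\<^sub>L (A o\<^sub>L W (t/2))"
    by (intro blinfun_eqI) (simp only: blinfun_apply_blinfun_compose)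
  moreover have "norm (A o\<^sub>L W (t/2)) \<le> 1 / (t/2)" using decay[of "t/2"] assms by simp
  ultimately show ?thesis
    using norm_compose_le[of "A o\<^sub>L W (t/2)" "1 / (t/2)" "A o\<^sub>L W (t/2)" "1 / (t/2)"]
    by (simp add: power2_eq_square)
qed

end

text \<open>
  The function \<open>Y(s) = W(t - s) A\<^sup>-\<^sup>1 B V(s)\<close> replaces \<open>W(t - s) V(s)\<close>, which is the integration by
  parts in advance: its
  derivative \<open>W(t - s)(B\<^sup>-\<^sup>1 - A\<^sup>-\<^sup>1) B\<^sup>2 V(s)\<close> puts all unboundedness on \<open>V(s)\<close>, where \<open>s \<ge> t/2\<close>, and
  contains the difference of the inverses as a factor. At the two ends
  \<open>A\<^sup>-\<^sup>1 B = 1 - (B\<^sup>-\<^sup>1 - A\<^sup>-\<^sup>1) B\<close> returns to \<open>W(t - s) V(s)\<close>.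
\<close>
lemma decaying_semigroup_half_compare:
  fixes A R B Q :: "'a::banach \<Rightarrow>\<^sub>L 'a"
  assumes "decaying_semigroup A R W" and "decaying_semigroup B Q V" and t: "0 < t"
  shows "norm (V t - (W (t/2) o\<^sub>L V (t/2))) \<le> 11 * norm (Q - R) / t"
proof -
  interpret W: decaying_semigroup A R W by fact
  interpret V: decaying_semigroup B Q V by fact
  let ?d = "norm (Q - R)" and ?h = "t / 2"
  define Y where "Y s = (W (t - s) o\<^sub>L R) o\<^sub>L (B o\<^sub>L V s)" for s
  have inv: "A (R x) = x" "Q (B x) = x" for x
    using W.right_inverse V.left_inverse
    by (metis blinfun_apply_blinfun_compose blinfun_apply_id_blinfun)+
  have com: "A (W r x) = W r (A x)" for r x
    using W.commute by (metis blinfun_apply_blinfun_compose)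
  have "norm (Y t - Y ?h) \<le> (16 * ?d / t\<^sup>2) * (t - ?h)"
  proof (rule norm_diff_le_of_derivative[where f = Y])
    fix s assume s: "s \<in> {?h..t}"
    have "((\<lambda>s. W (t - s)) has_vector_derivative ((-1) *\<^sub>R - (A o\<^sub>L W (t - s)))) (at s)"
      by (rule vector_diff_chain_at[unfolded o_def, OF _ W.deriv])
        (auto intro!: derivative_eq_intros)
    then have W': "((\<lambda>s. W (t - s) o\<^sub>L R) has_vector_derivative (A o\<^sub>L W (t - s)) o\<^sub>L R) (at s)"
      using bounded_linear.has_vector_derivative[OF bounded_bilinear.bounded_linear_left
          [OF bounded_bilinear_blinfun_compose, of R]] by fastforce
    have V': "((\<lambda>s. B o\<^sub>L V s) has_vector_derivative B o\<^sub>L - (B o\<^sub>L V s)) (at s)"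
      by (rule compose_left_has_vector_derivative[OF V.deriv])
    have "(Y has_vector_derivative
        ((W (t - s) o\<^sub>L R) o\<^sub>L (B o\<^sub>L - (B o\<^sub>L V s))) + (((A o\<^sub>L W (t - s)) o\<^sub>L R) o\<^sub>L (B o\<^sub>L V s)))
        (at s)"
      unfolding Y_def
      by (rule bounded_bilinear.has_vector_derivative[OF bounded_bilinear_blinfun_compose W' V'])
    \<comment> \<open>here \<open>A\<close> cancels its inverse, and \<open>1 - A\<^sup>-\<^sup>1 B = (B\<^sup>-\<^sup>1 - A\<^sup>-\<^sup>1) B\<close>\<close>
    moreover have "((W (t - s) o\<^sub>L R) o\<^sub>L (B o\<^sub>L - (B o\<^sub>L V s))) + (((A o\<^sub>L W (t - s)) o\<^sub>L R) o\<^sub>L (B o\<^sub>L V s))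
        = W (t - s) o\<^sub>L ((Q - R) o\<^sub>L (B o\<^sub>L (B o\<^sub>L V s)))"
      by (rule blinfun_eqI) (simp add: blinfun.bilinear_simps com inv)
    ultimately have "(Y has_vector_derivative W (t - s) o\<^sub>L ((Q - R) o\<^sub>L (B o\<^sub>L (B o\<^sub>L V s)))) (at s)"
      by (simp only:)
    then show "(Y has_vector_derivative W (t - s) o\<^sub>L ((Q - R) o\<^sub>L (B o\<^sub>L (B o\<^sub>L V s)))) (at s within {?h..t})"
      by (rule has_vector_derivative_at_within)
    have s0: "0 < s" "0 \<le> t - s" using s t by auto
    have "norm (W (t - s) o\<^sub>L ((Q - R) o\<^sub>L (B o\<^sub>L (B o\<^sub>L V s)))) \<le> 1 * (?d * (4 / s\<^sup>2))"
      by (intro norm_compose_le W.norm_le V.decay_square order_refl s0)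
    also have "\<dots> \<le> 1 * (?d * (4 / ?h\<^sup>2))"
      using s t by (intro mult_left_mono divide_left_mono power_mono) auto
    also have "\<dots> = 16 * ?d / t\<^sup>2" by (simp add: power2_eq_square)
    finally show "norm (W (t - s) o\<^sub>L ((Q - R) o\<^sub>L (B o\<^sub>L (B o\<^sub>L V s)))) \<le> 16 * ?d / t\<^sup>2" .
  qed (use t in auto)
  also have "\<dots> = 8 * ?d / t" using t by (simp add: power2_eq_square field_simps)
  finally have 1: "norm (Y t - Y ?h) \<le> 8 * ?d / t" .
  have "norm ((Q - R) o\<^sub>L (B o\<^sub>L V t)) \<le> ?d * (1 / t)"
    by (intro norm_compose_le V.decay order_refl t)
  then have 2: "norm ((Q - R) o\<^sub>L (B o\<^sub>L V t)) \<le> ?d / t" by simp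
  have "norm (W ?h o\<^sub>L ((Q - R) o\<^sub>L (B o\<^sub>L V ?h))) \<le> 1 * (?d * (1 / ?h))"
    using t by (intro norm_compose_le V.decay W.norm_le order_refl) auto
  then have 3: "norm (W ?h o\<^sub>L ((Q - R) o\<^sub>L (B o\<^sub>L V ?h))) \<le> 2 * ?d / t" by (simp add: mult.commute)
  have "V t - (W ?h o\<^sub>L V ?h) = (Y t - Y ?h) + ((Q - R) o\<^sub>L (B o\<^sub>L V t))
      - (W ?h o\<^sub>L ((Q - R) o\<^sub>L (B o\<^sub>L V ?h)))"
    by (rule blinfun_eqI) (simp add: Y_def blinfun.bilinear_simps inv W.zero)
  moreover have "norm (a + b - c) \<le> norm a + norm b + norm c" for a b c :: "'a \<Rightarrow>\<^sub>L 'a"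
    by (rule order_trans[OF norm_triangle_ineq4 add_right_mono[OF norm_triangle_ineq]])
  ultimately have "norm (V t - (W ?h o\<^sub>L V ?h)) \<le> norm (Y t - Y ?h) + norm ((Q - R) o\<^sub>L (B o\<^sub>L V t))
      + norm (W ?h o\<^sub>L ((Q - R) o\<^sub>L (B o\<^sub>L V ?h)))"
    by (simp only:)
  also have "\<dots> \<le> 8 * ?d / t + ?d / t + 2 * ?d / t" using 1 2 3 by linarith
  also have "\<dots> = 11 * ?d / t" using t by (simp add: field_simps)
  finally show ?thesis .
qed

lemma norm_adjoint_le:
  fixes X X' :: "'a::real_inner \<Rightarrow>\<^sub>L 'a"
  assumes "\<And>x y. inner (X x) y = inner x (X' y)"
  shows "norm X' \<le> norm X"
proof (rule norm_blinfun_bound[OF norm_ge_zero])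
  fix y
  have "norm (X' y) * norm (X' y) = inner (X (X' y)) y"
    using assms[of "X' y" y] by (simp add: dot_square_norm power2_eq_square)
  also have "\<dots> \<le> norm (X (X' y)) * norm y" by (rule norm_cauchy_schwarz)
  also have "\<dots> \<le> (norm X * norm (X' y)) * norm y"
    by (intro mult_right_mono norm_blinfun) auto
  finally have *: "norm (X' y) * norm (X' y) \<le> (norm X * norm y) * norm (X' y)"
    by (simp add: ac_simps)
  show "norm (X' y) \<le> norm X * norm y"
  proof (cases "X' y = 0")
    case False then show ?thesis using mult_right_le_imp_le[OF *] by simp
  qed simp
qed

text \<open>
  Exchanging the two semigroups compares \<open>W(t)\<close> with \<open>V(t/2) W(t/2)\<close>; passing to adjoints reverses
  this product, so that both halves meet in \<open>W(t/2) V(t/2)\<close>.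
\<close>
lemma decaying_semigroup_compare:
  fixes A R B Q :: "'a::{real_inner, banach} \<Rightarrow>\<^sub>L 'a"
  assumes W: "decaying_semigroup A R W" and V: "decaying_semigroup B Q V" and t: "0 < t"
    and sym: "\<And>s. symmetric_op (W s)" "\<And>s. symmetric_op (V s)"
  shows "norm (V t - W t) \<le> 22 * norm (Q - R) / t"
proof -
  have "norm (V t - (W (t/2) o\<^sub>L V (t/2))) \<le> 11 * norm (Q - R) / t"
    by (rule decaying_semigroup_half_compare[OF W V t])
  moreover have "norm (W t - (W (t/2) o\<^sub>L V (t/2))) \<le> norm (W t - (V (t/2) o\<^sub>L W (t/2)))"
    by (rule norm_adjoint_le)
      (simp add: blinfun.bilinear_simps inner_simps symmetric_opD[OF sym(1)] symmetric_opD[OF sym(2)])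
  moreover have "norm (W t - (V (t/2) o\<^sub>L W (t/2))) \<le> 11 * norm (Q - R) / t"
    using decaying_semigroup_half_compare[OF V W t] by (simp add: norm_minus_commute)
  moreover have "norm (V t - W t)
      \<le> norm (V t - (W (t/2) o\<^sub>L V (t/2))) + norm (W t - (W (t/2) o\<^sub>L V (t/2)))"
    using norm_triangle_ineq4[of "V t - (W (t/2) o\<^sub>L V (t/2))" "W t - (W (t/2) o\<^sub>L V (t/2))"] by simp
  ultimately show ?thesis by linarith
qed

text \<open>
  The shift by \<open>1\<close> costs nothing in the decay: \<open>e\<^sup>-\<^sup>t(1 + 1/t) \<le> 1/t\<close>.
\<close>
lemma decaying_semigroup_poisson:
  fixes G R :: "'a::{real_inner, banach} \<Rightarrow>\<^sub>L 'a"
  assumes G: "pos_contraction G" and \<tau>: "0 < \<tau>"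
    and inv: "(id_blinfun + (id_blinfun - G) /\<^sub>R \<tau>) o\<^sub>L R = id_blinfun"
      "R o\<^sub>L (id_blinfun + (id_blinfun - G) /\<^sub>R \<tau>) = id_blinfun"
  shows "decaying_semigroup (id_blinfun + (id_blinfun - G) /\<^sub>R \<tau>) R
    (\<lambda>t. exp (- t) *\<^sub>R poisson_op G (t / \<tau>))"
proof
  let ?N = "id_blinfun - G"
  have n: "norm G \<le> 1" using G by (simp add: pos_contraction_def)
  have c: "G o\<^sub>L poisson_op G r = poisson_op G r o\<^sub>L G" for r
    by (rule poisson_op_commute[OF n]) simp
  show "(id_blinfun + ?N /\<^sub>R \<tau>) o\<^sub>L R = id_blinfun" "R o\<^sub>L (id_blinfun + ?N /\<^sub>R \<tau>) = id_blinfun"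
    by fact+
  show "(id_blinfun + ?N /\<^sub>R \<tau>) o\<^sub>L (exp (- t) *\<^sub>R poisson_op G (t / \<tau>))
      = (exp (- t) *\<^sub>R poisson_op G (t / \<tau>)) o\<^sub>L (id_blinfun + ?N /\<^sub>R \<tau>)" for t
    by (simp add: compose_simps c scaleR_add_right scaleR_diff_right mult.commute)
  show "((\<lambda>t. exp (- t) *\<^sub>R poisson_op G (t / \<tau>)) has_vector_derivative
      - ((id_blinfun + ?N /\<^sub>R \<tau>) o\<^sub>L (exp (- t) *\<^sub>R poisson_op G (t / \<tau>)))) (at t)" for t
  proof -
    have "((\<lambda>t. poisson_op G (t / \<tau>)) has_vector_derivative
        ((1 / \<tau>) *\<^sub>R - (?N o\<^sub>L poisson_op G (t / \<tau>)))) (at t)"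
      by (rule vector_diff_chain_at[unfolded o_def, OF _ poisson_op_deriv[OF n]])
        (use \<tau> in \<open>auto intro!: derivative_eq_intros\<close>)
    then have "((\<lambda>t. exp (- t) *\<^sub>R poisson_op G (t / \<tau>)) has_vector_derivative
      (exp (- t) *\<^sub>R ((1 / \<tau>) *\<^sub>R - (?N o\<^sub>L poisson_op G (t / \<tau>)))
        + (- exp (- t)) *\<^sub>R poisson_op G (t / \<tau>))) (at t)"
      by (intro has_vector_derivative_scaleR) (auto intro!: derivative_eq_intros)
    moreover have "exp (- t) *\<^sub>R ((1 / \<tau>) *\<^sub>R - (?N o\<^sub>L poisson_op G (t / \<tau>)))
        + (- exp (- t)) *\<^sub>R poisson_op G (t / \<tau>)
      = - ((id_blinfun + ?N /\<^sub>R \<tau>) o\<^sub>L (exp (- t) *\<^sub>R poisson_op G (t / \<tau>)))"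
      by (simp add: compose_simps scaleR_add_right scaleR_diff_right inverse_eq_divide)
    ultimately show ?thesis by simp
  qed
  show "exp (- 0) *\<^sub>R poisson_op G (0 / \<tau>) = id_blinfun" by simp
  show "exp (- (s + t)) *\<^sub>R poisson_op G ((s + t) / \<tau>)
      = (exp (- s) *\<^sub>R poisson_op G (s / \<tau>)) o\<^sub>L (exp (- t) *\<^sub>R poisson_op G (t / \<tau>))" for s t
    by (simp add: compose_simps add_divide_distrib poisson_op_add[OF n] exp_add[symmetric])
  show "norm (exp (- t) *\<^sub>R poisson_op G (t / \<tau>)) \<le> 1" if "0 \<le> t" for t
  proof -
    have "exp (- t) * norm (poisson_op G (t / \<tau>)) \<le> 1 * 1"
      using that \<tau> by (intro mult_mono norm_poisson_op_le[OF n]) auto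
    then show ?thesis by simp
  qed
  show "norm ((id_blinfun + ?N /\<^sub>R \<tau>) o\<^sub>L (exp (- t) *\<^sub>R poisson_op G (t / \<tau>))) \<le> 1 / t"
    if t: "0 < t" for t
  proof -
    let ?P = "poisson_op G (t / \<tau>)"
    have "norm (?P + (?N o\<^sub>L ?P) /\<^sub>R \<tau>) \<le> norm ?P + norm (?N o\<^sub>L ?P) / \<tau>"
      using norm_triangle_ineq[of ?P "(?N o\<^sub>L ?P) /\<^sub>R \<tau>"] \<tau> by (simp add: divide_inverse mult.commute)
    also have "\<dots> \<le> 1 + (1 / (t / \<tau>)) / \<tau>"
      using t \<tau> by (intro add_mono divide_right_mono norm_poisson_op_le[OF n]
          norm_poisson_op_defect_le[OF G]) auto
    also have "\<dots> = (1 + t) / t" using t \<tau> by (simp add: field_simps)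
    finally have "exp (- t) * norm (?P + (?N o\<^sub>L ?P) /\<^sub>R \<tau>) \<le> exp (- t) * ((1 + t) / t)"
      by (intro mult_left_mono) auto
    also have "\<dots> \<le> exp (- t) * (exp t / t)"
      using t by (intro mult_left_mono divide_right_mono exp_ge_add_one_self) auto
    also have "\<dots> = 1 / t" by (simp add: mult_exp_exp)
    finally have "norm (exp (- t) *\<^sub>R (?P + (?N o\<^sub>L ?P) /\<^sub>R \<tau>)) \<le> 1 / t" by simp
    then show ?thesis by (simp add: compose_simps)
  qed
qed

theorem poisson_op_resolvent_compare:
  fixes G K R Q :: "'a::{real_inner, banach} \<Rightarrow>\<^sub>L 'a"
  assumes G: "pos_contraction G" and \<tau>: "0 < \<tau>"
    and R: "(id_blinfun + (id_blinfun - G) /\<^sub>R \<tau>) o\<^sub>L R = id_blinfun"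
      "R o\<^sub>L (id_blinfun + (id_blinfun - G) /\<^sub>R \<tau>) = id_blinfun"
    and K: "pos_contraction K" and \<sigma>: "0 < \<sigma>"
    and Q: "(id_blinfun + (id_blinfun - K) /\<^sub>R \<sigma>) o\<^sub>L Q = id_blinfun"
      "Q o\<^sub>L (id_blinfun + (id_blinfun - K) /\<^sub>R \<sigma>) = id_blinfun"
    and t: "0 < t"
  shows "norm (poisson_op G (t / \<tau>) - poisson_op K (t / \<sigma>)) \<le> 22 * exp t * norm (R - Q) / t"
proof -
  let ?W = "\<lambda>t. exp (- t) *\<^sub>R poisson_op G (t / \<tau>)" and ?V = "\<lambda>t. exp (- t) *\<^sub>R poisson_op K (t / \<sigma>)"
  have sym: "symmetric_op (c *\<^sub>R poisson_op G s)" if "pos_contraction G" for c s and G :: "'a \<Rightarrow>\<^sub>L 'a"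
    using that symmetric_poisson_op[of G s]
    by (simp add: pos_contraction_def symmetric_op_def blinfun.bilinear_simps)
  have "norm (?W t - ?V t) \<le> 22 * norm (R - Q) / t"
    by (rule decaying_semigroup_compare[OF decaying_semigroup_poisson[OF K \<sigma> Q]
          decaying_semigroup_poisson[OF G \<tau> R] t sym[OF K] sym[OF G]])
  moreover have "norm (?W t - ?V t) = exp (- t) * norm (poisson_op G (t / \<tau>) - poisson_op K (t / \<sigma>))"
    by (simp add: scaleR_diff_right[symmetric])
  ultimately have "exp t * (exp (- t) * norm (poisson_op G (t / \<tau>) - poisson_op K (t / \<sigma>)))
      \<le> exp t * (22 * norm (R - Q) / t)" by (intro mult_left_mono) auto
  then show ?thesis by (simp add: mult.assoc[symmetric] mult_exp_exp) (simp add: ac_simps)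
qed

section \<open>Resolvents of non-negative self-adjoint operators\<close>

text \<open>
  A minimizing sequence for the distance from \<open>y\<close> to \<open>K\<close> is Cauchy by the parallelogram law.
\<close>
lemma orthogonal_projection_exists:
  fixes K :: "'a::real_inner set"
  assumes K: "subspace K" "complete K"
  shows "\<exists>k\<in>K. \<forall>v\<in>K. inner (y - k) v = 0"
proof -
  define d where "d = (INF k\<in>K. (norm (y - k))\<^sup>2)"
  have bdd: "bdd_below ((\<lambda>k. (norm (y - k))\<^sup>2) ` K)" by (rule bdd_belowI[of _ 0]) auto
  have d: "d \<le> (norm (y - k))\<^sup>2" if "k \<in> K" for k
    unfolding d_def by (rule cINF_lower[OF bdd that])
  have "\<exists>k\<in>K. (norm (y - k))\<^sup>2 < d + inverse (real (Suc n))" for n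
  proof -
    have "(INF k\<in>K. (norm (y - k))\<^sup>2) < d + inverse (real (Suc n))" unfolding d_def[symmetric] by simp
    then show ?thesis using cINF_less_iff[OF _ bdd] subspace_0[OF K(1)] by (metis empty_iff)
  qed
  then obtain k where k: "\<And>n. k n \<in> K" "\<And>n. (norm (y - k n))\<^sup>2 < d + inverse (real (Suc n))"
    by metis
  have par: "(norm (k m - k n))\<^sup>2 \<le> 2 * inverse (real (Suc m)) + 2 * inverse (real (Suc n))" for m n
  proof -
    have "(1/2) *\<^sub>R (k m + k n) \<in> K"
      using K(1) k(1) by (intro subspace_scale subspace_add)
    note d[OF this]
    moreover have "(norm (k m - k n))\<^sup>2 = 2 * (norm (y - k m))\<^sup>2 + 2 * (norm (y - k n))\<^sup>2
        - 4 * (norm (y - (1/2) *\<^sub>R (k m + k n)))\<^sup>2"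
      by (simp add: power2_norm_eq_inner inner_simps inner_commute algebra_simps)
    ultimately show ?thesis using k(2)[of m] k(2)[of n] by linarith
  qed
  have "Cauchy k"
  proof (rule metric_CauchyI)
    fix e :: real assume "0 < e"
    then obtain N where N: "inverse (real (Suc N)) < e\<^sup>2 / 4"
      using reals_Archimedean[of "e\<^sup>2/4"] by auto
    have "dist (k m) (k n) < e" if "m \<ge> N" "n \<ge> N" for m n
    proof -
      have "inverse (real (Suc m)) \<le> inverse (real (Suc N))" "inverse (real (Suc n)) \<le> inverse (real (Suc N))"
        using that by (simp_all add: le_imp_inverse_le)
      then have "(norm (k m - k n))\<^sup>2 < e\<^sup>2" using par[of m n] N by linarith
      then show ?thesis using \<open>0 < e\<close> by (simp add: dist_norm power2_less_imp_less)
    qed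
    then show "\<exists>M. \<forall>m\<ge>M. \<forall>n\<ge>M. dist (k m) (k n) < e" by blast
  qed
  then obtain l where l: "l \<in> K" "k \<longlonglongrightarrow> l"
    using K(2) k(1) unfolding complete_def by blast
  have "(norm (y - l))\<^sup>2 \<le> d"
  proof (rule LIMSEQ_le)
    show "(\<lambda>n. (norm (y - k n))\<^sup>2) \<longlonglongrightarrow> (norm (y - l))\<^sup>2" by (intro tendsto_intros l)
    show "(\<lambda>n. d + inverse (real (Suc n))) \<longlonglongrightarrow> d"
      using tendsto_add[OF tendsto_const LIMSEQ_inverse_real_of_nat, of d] by simp
  qed (use k(2) less_imp_le in blast)
  note le = this
  have min: "(norm (y - l))\<^sup>2 \<le> (norm (y - l - s *\<^sub>R v))\<^sup>2" if "v \<in> K" for s v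
  proof -
    have "l + s *\<^sub>R v \<in> K" by (intro subspace_add subspace_scale K l that)
    from order_trans[OF le d[OF this]] show ?thesis by (simp only: diff_diff_add)
  qed
  have "inner (y - l) v = 0" if v: "v \<in> K" for v
  proof (rule ccontr)
    assume n: "inner (y - l) v \<noteq> 0"
    then have "v \<noteq> 0" by auto
    then have p: "0 < inner v v" by simp
    let ?s = "inner (y - l) v / inner v v"
    have "(norm (y - l - ?s *\<^sub>R v))\<^sup>2 = (norm (y - l))\<^sup>2 - (inner (y - l) v)\<^sup>2 / inner v v"
    proof -
      have "(norm (w - s *\<^sub>R v))\<^sup>2 = (norm w)\<^sup>2 - 2 * s * inner w v + s * s * inner v v" for w s
        by (simp add: power2_norm_eq_inner inner_simps inner_commute algebra_simps)
      from this[of "y - l" ?s] show ?thesis using p by (simp add: power2_eq_square field_simps)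
    qed
    moreover have "0 < (inner (y - l) v)\<^sup>2 / inner v v" using n p by simp
    ultimately show False using min[OF v, of ?s] by linarith
  qed
  then show ?thesis using l(1) by blast
qed

lemma zero_if_orthogonal_to_dense:
  assumes "closure D = UNIV" "\<And>x. x \<in> D \<Longrightarrow> inner w x = 0" shows "w = 0"
proof -
  have "closed {x. inner w x = 0}" by (intro closed_Collect_eq continuous_intros)
  then have "closure D \<subseteq> {x. inner w x = 0}" using assms(2) by (intro closure_minimal) auto
  then have "w \<in> {x. inner w x = 0}" using assms(1) by blast
  then show ?thesis by simp
qed

text \<open>
  Self-adjointness expressed through the real inner product: the condition \<open>adjoint_iff\<close> contains
  both symmetry and maximality of the domain. Bounded operators are the case \<open>D = UNIV\<close>.
\<close>
locale nonneg_self_adjoint =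
  fixes D :: "'a::chilbert_space set" and T :: "'a \<Rightarrow> 'a"
  assumes subspace: "subspace D"
    and add: "x \<in> D \<Longrightarrow> y \<in> D \<Longrightarrow> T (x + y) = T x + T y"
    and scale: "x \<in> D \<Longrightarrow> T (c *\<^sub>R x) = c *\<^sub>R T x"
    and adjoint_iff: "(\<forall>x\<in>D. inner y (T x) = inner z x) \<longleftrightarrow> y \<in> D \<and> T y = z"
    and nonneg: "x \<in> D \<Longrightarrow> 0 \<le> inner x (T x)"
begin

lemma symmetric: "x \<in> D \<Longrightarrow> y \<in> D \<Longrightarrow> inner y (T x) = inner (T y) x"
  using adjoint_iff[of y "T y"] by blast

lemma diff: "x \<in> D \<Longrightarrow> y \<in> D \<Longrightarrow> T (x - y) = T x - T y"
  using add[of x "(-1) *\<^sub>R y"] scale[of y "-1"] subspace_scale[OF subspace, of y "-1"] by simp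

lemma norm_le_one_plus:
  assumes "x \<in> D" shows "norm x \<le> norm (x + T x)"
proof (cases "x = 0")
  case False
  have "norm x * norm x \<le> inner x (x + T x)"
    using nonneg[OF assms] by (simp add: inner_simps dot_square_norm power2_eq_square)
  also have "\<dots> \<le> norm x * norm (x + T x)" by (rule norm_cauchy_schwarz)
  finally show ?thesis using False by simp
qed simp

lemma one_plus_inj: "inj_on (\<lambda>x. x + T x) D"
proof (rule inj_onI)
  fix x y assume xy: "x \<in> D" "y \<in> D" "x + T x = y + T y"
  then have "x - y + T (x - y) = 0" by (simp add: diff algebra_simps)
  then show "x = y" using norm_le_one_plus[of "x - y"] subspace_diff[OF subspace xy(1,2)] by simp
qed

text \<open>
  The range of \<open>1 + T\<close> is complete, as \<open>T\<close> is closed and \<open>1 + T\<close> is bounded below. A vector \<open>z\<close>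
  orthogonal to it satisfies \<open>Tz = -z\<close> by self-adjointness, and then \<open>z = 0\<close> by \<open>T \<ge> 0\<close>.
\<close>
lemma one_plus_surj: "(\<lambda>x. x + T x) ` D = UNIV"
proof -
  let ?K = "(\<lambda>x. x + T x) ` D"
  have D0: "T 0 = 0" using scale[OF subspace_0[OF subspace], of 0] by simp
  have sub: "subspace ?K"
    unfolding subspace_def
  proof (intro conjI ballI allI)
    show "0 \<in> ?K" using D0 subspace_0[OF subspace] by force
    show "a + b \<in> ?K" if ab: "a \<in> ?K" "b \<in> ?K" for a b
    proof -
      obtain x y where "x \<in> D" "y \<in> D" "a = x + T x" "b = y + T y" using ab by auto
      then show ?thesis
        by (intro image_eqI[of _ _ "x + y"]) (simp_all add: add subspace_add[OF subspace])
    qed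
    show "c *\<^sub>R a \<in> ?K" if a: "a \<in> ?K" for a c
    proof -
      obtain x where "x \<in> D" "a = x + T x" using a by auto
      then show ?thesis
        by (intro image_eqI[of _ _ "c *\<^sub>R x"])
          (simp_all add: scale scaleR_add_right subspace_scale[OF subspace])
    qed
  qed
  have com: "complete ?K"
    unfolding complete_def
  proof (intro allI impI, elim conjE)
    fix k assume k: "\<forall>n. k n \<in> ?K" "Cauchy k"
    then have "\<forall>n. \<exists>x. x \<in> D \<and> k n = x + T x" by blast
    then obtain x where x: "\<And>n. x n \<in> D" "\<And>n. k n = x n + T (x n)" by metis
    have le: "dist (x m) (x n) \<le> dist (k m) (k n)" for m n
      using norm_le_one_plus[of "x m - x n"] subspace_diff[OF subspace x(1)[of m] x(1)[of n]]
      by (simp add: dist_norm x(2) diff[OF x(1) x(1)] algebra_simps)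
    have "Cauchy x"
    proof (rule metric_CauchyI)
      fix e :: real assume "0 < e"
      from metric_CauchyD[OF k(2) this] show "\<exists>M. \<forall>m\<ge>M. \<forall>n\<ge>M. dist (x m) (x n) < e"
        using le le_less_trans by meson
    qed
    then obtain w where w: "x \<longlonglongrightarrow> w" using Cauchy_convergent convergent_def by blast
    obtain y where y: "k \<longlonglongrightarrow> y" using k(2) Cauchy_convergent convergent_def by blast
    have Tx: "T (x n) = k n - x n" for n using x(2)[of n] by simp
    have "inner w (T v) = inner (y - w) v" if "v \<in> D" for v
    proof (rule LIMSEQ_unique)
      show "(\<lambda>n. inner (x n) (T v)) \<longlonglongrightarrow> inner w (T v)" by (intro tendsto_intros w)
      have "(\<lambda>n. inner (k n - x n) v) \<longlonglongrightarrow> inner (y - w) v" by (intro tendsto_intros w y)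
      then show "(\<lambda>n. inner (x n) (T v)) \<longlonglongrightarrow> inner (y - w) v"
        by (simp add: symmetric[OF that x(1)] Tx)
    qed
    then have "w \<in> D" "T w = y - w" using adjoint_iff[of w "y - w"] by auto
    then have "y \<in> ?K" by (intro image_eqI[of _ _ w]) auto
    then show "\<exists>l\<in>?K. k \<longlonglongrightarrow> l" using y by blast
  qed
  have "y \<in> ?K" for y
  proof -
    obtain l where l: "l \<in> ?K" "\<forall>v\<in>?K. inner (y - l) v = 0"
      using orthogonal_projection_exists[OF sub com] by blast
    then have "inner (y - l) (T x) = inner (- (y - l)) x" if "x \<in> D" for x
      using that by (auto simp: inner_add_right inner_minus_left add_eq_0_iff2 simp del: minus_diff_eq)
    then have "y - l \<in> D" "T (y - l) = - (y - l)" using adjoint_iff[of "y - l" "- (y - l)"] by auto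
    then have "0 \<le> - inner (y - l) (y - l)" using nonneg by (metis inner_minus_right)
    then have "y = l" by (metis eq_iff_diff_eq_0 inner_ge_zero inner_eq_zero_iff neg_0_le_iff_le order_antisym)
    then show ?thesis using l(1) by simp
  qed
  then show ?thesis by blast
qed

definition resolvent :: "'a \<Rightarrow>\<^sub>L 'a" where "resolvent = bounded_inverse D (\<lambda>x. x + T x)"

lemma resolvent_apply: "resolvent y = the_inv_into D (\<lambda>x. x + T x) y"
proof -
  let ?g = "the_inv_into D (\<lambda>x. x + T x)"
  have g: "?g y \<in> D" "?g y + T (?g y) = y" for y
    using the_inv_into_into[OF one_plus_inj, of y D] f_the_inv_into_f[OF one_plus_inj, of y] one_plus_surj
    by auto
  have uniq: "?g (x + T x) = x" if "x \<in> D" for x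
    using the_inv_into_f_f[OF one_plus_inj that] by simp
  have "bounded_linear ?g"
  proof (rule bounded_linear_intro[where K = 1])
    show "?g (x + y) = ?g x + ?g y" for x y
    proof -
      have "x + y = (?g x + ?g y) + T (?g x + ?g y)"
        using g(2)[of x] g(2)[of y] by (simp add: add g(1) algebra_simps)
      then show ?thesis using uniq[of "?g x + ?g y"] subspace_add[OF subspace g(1) g(1)] by metis
    qed
    show "?g (c *\<^sub>R x) = c *\<^sub>R ?g x" for c x
    proof -
      have "c *\<^sub>R x = c *\<^sub>R ?g x + T (c *\<^sub>R ?g x)"
        using g(2)[of x] by (simp add: scale[OF g(1)] scaleR_add_right[symmetric])
      then show ?thesis using uniq[of "c *\<^sub>R ?g x"] subspace_scale[OF subspace g(1)] by metis
    qed
    show "norm (?g x) \<le> norm x * 1" for x using norm_le_one_plus[OF g(1), of x] g(2) by simp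
  qed
  then show ?thesis by (simp add: resolvent_def bounded_inverse_def bounded_linear_Blinfun_apply)
qed

lemma resolvent_in: "resolvent y \<in> D"
  and one_plus_resolvent: "resolvent y + T (resolvent y) = y"
  using the_inv_into_into[OF one_plus_inj, of y D] f_the_inv_into_f[OF one_plus_inj, of y] one_plus_surj
  by (auto simp: resolvent_apply)

lemma resolvent_one_plus: "x \<in> D \<Longrightarrow> resolvent (x + T x) = x"
  using the_inv_into_f_f[OF one_plus_inj] by (simp add: resolvent_apply)

lemma norm_resolvent_le: "norm resolvent \<le> 1"
  by (rule norm_blinfun_bound) (use norm_le_one_plus[OF resolvent_in] in \<open>simp_all add: one_plus_resolvent\<close>)

end

lemma nonneg_self_adjoint_blinfun:
  fixes S :: "'a::chilbert_space \<Rightarrow>\<^sub>L 'a"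
  assumes sym: "\<And>x y. inner (S x) y = inner x (S y)" and pos: "\<And>x. 0 \<le> inner x (S x)"
  shows "nonneg_self_adjoint UNIV S"
proof
  show "(\<forall>x\<in>UNIV. inner y (S x) = inner z x) \<longleftrightarrow> y \<in> UNIV \<and> S y = z" for y z
    using vector_eq_rdot[of "S y" z] by (simp add: sym)
qed (use pos in \<open>auto simp: blinfun.bilinear_simps\<close>)

lemma cinner_scaleC_left: "cinner (a *\<^sub>C x) y = cnj a * cinner x y"
  by (metis cinner_commute cinner_scaleC_right complex_cnj_mult)

lemma cinner_eq_Complex: "cinner x y = Complex (inner x y) (inner (\<i> *\<^sub>C x) y)"
  by (simp add: complex_eq_iff inner_eq_Re_cinner cinner_scaleC_left)

lemma inner_scaleC_i:
  fixes x y :: "'a::complex_inner"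
  shows "inner (\<i> *\<^sub>C x) y = - inner x (\<i> *\<^sub>C y)"
  by (simp add: inner_eq_Re_cinner cinner_scaleC_left cinner_scaleC_right)

text \<open>
  Replacing \<open>x\<close> by \<open>\<i>x\<close> recovers the imaginary part of the complex inner product from the real one.
\<close>
lemma self_adjoint_imp_adjoint_iff:
  assumes sa: "self_adjoint D T"
  shows "(\<forall>x\<in>D. inner y (T x) = inner z x) \<longleftrightarrow> y \<in> D \<and> T y = z"
proof -
  have op: "is_operator D T" and dense: "closure D = UNIV" and dom: "adjoint_dom D T = D"
    and eq: "\<And>x. x \<in> D \<Longrightarrow> adjoint_op D T x = T x"
    using sa by (auto simp: self_adjoint_def)
  have adj: "adjoint_op D T y = w" if w: "\<forall>x\<in>D. cinner y (T x) = cinner w x" for w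
    unfolding adjoint_op_def
  proof (rule the_equality)
    show "\<forall>x\<in>D. cinner y (T x) = cinner w x" by (rule w)
    fix w' assume "\<forall>x\<in>D. cinner y (T x) = cinner w' x"
    then have "inner w' x = inner w x" if "x \<in> D" for x
      using that w by (simp add: inner_eq_Re_cinner)
    then have "inner (w' - w) x = 0" if "x \<in> D" for x
      using that by (simp add: inner_diff_left)
    then show "w' = w" using zero_if_orthogonal_to_dense[OF dense] by (metis eq_iff_diff_eq_0)
  qed
  show ?thesis
  proof
    assume *: "\<forall>x\<in>D. inner y (T x) = inner z x"
    have "cinner y (T x) = cinner z x" if x: "x \<in> D" for x
    proof -
      have "\<i> *\<^sub>C x \<in> D" "T (\<i> *\<^sub>C x) = \<i> *\<^sub>C T x" using op x by (auto simp: is_operator_def)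
      then have "inner y (\<i> *\<^sub>C T x) = inner z (\<i> *\<^sub>C x)" using * by metis
      then show ?thesis using * x by (simp add: cinner_eq_Complex inner_scaleC_i)
    qed
    then have c: "\<forall>x\<in>D. cinner y (T x) = cinner z x" by blast
    then have "y \<in> adjoint_dom D T" unfolding adjoint_dom_def by (intro CollectI exI)
    then have "y \<in> D" by (simp only: dom)
    then show "y \<in> D \<and> T y = z" using eq[of y] adj[OF c] by simp
  next
    assume y: "y \<in> D \<and> T y = z"
    then have "y \<in> adjoint_dom D T" by (simp only: dom)
    then obtain w where w: "\<forall>x\<in>D. cinner y (T x) = cinner w x"
      unfolding adjoint_dom_def by (elim CollectE exE)
    then have "w = z" using adj[OF w] eq[of y] y by simp
    then show "\<forall>x\<in>D. inner y (T x) = inner z x" using w by (simp add: inner_eq_Re_cinner)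
  qed
qed

lemma self_adjoint_imp_nonneg_self_adjoint:
  assumes sa: "self_adjoint D T" and pos: "nonneg_op D T"
  shows "nonneg_self_adjoint D T"
proof
  have op: "is_operator D T" using sa by (simp add: self_adjoint_def)
  show "subspace D"
    using op by (auto simp: subspace_def is_operator_def scaleR_scaleC)
  show "T (x + y) = T x + T y" if "x \<in> D" "y \<in> D" for x y
    using op that by (auto simp: is_operator_def)
  show "T (c *\<^sub>R x) = c *\<^sub>R T x" if "x \<in> D" for x c
    using op that by (auto simp: is_operator_def scaleR_scaleC)
  show "0 \<le> inner x (T x)" if "x \<in> D" for x
    using pos that by (auto simp: nonneg_op_def inner_eq_Re_cinner complex_nonneg_Reals_iff)
qed (rule self_adjoint_imp_adjoint_iff[OF sa])

section \<open>Strongly continuous semigroups and their uniqueness\<close>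

text \<open>
  By Baire's theorem one of the closed sets \<open>{x. \<forall>i. \<parallel>T\<^sub>i x\<parallel> \<le> k}\<close> contains a ball.
\<close>
lemma uniform_boundedness:
  fixes T :: "'i \<Rightarrow> 'a::banach \<Rightarrow>\<^sub>L 'b::real_normed_vector"
  assumes ptw: "\<And>x. \<exists>c. \<forall>i. norm (T i x) \<le> c"
  shows "\<exists>c. \<forall>i. norm (T i) \<le> c"
proof -
  define C where "C k = {x. \<forall>i. norm (T i x) \<le> real k}" for k
  have closed: "closed (C k)" for k
  proof -
    have "C k = (\<Inter>i. {x. norm (T i x) \<le> real k})" by (auto simp: C_def)
    then show ?thesis
      by (auto intro!: closed_INT closed_Collect_le continuous_intros)
  qed
  have all: "\<Union>(range C) = UNIV"
  proof -
    have "\<exists>k. x \<in> C k" for x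
    proof -
      obtain c where c: "\<And>i. norm (T i x) \<le> c" using ptw by blast
      obtain k where "c \<le> real k" using real_arch_simple by blast
      then show ?thesis using c order_trans unfolding C_def by blast
    qed
    then show ?thesis by blast
  qed
  have "\<exists>k. interior (C k) \<noteq> {}"
  proof (rule ccontr)
    assume no: "\<nexists>k. interior (C k) \<noteq> {}"
    have "Met_TC.mtopology interior_of (\<Union>(range C)) = {}"
    proof (rule Met_TC.metric_Baire_category_alt)
      show "Met_TC.mcomplete TYPE('a)"
        by (simp add: Met_TC.mcomplete_def Cauchy_convergent_iff convergent_def complete_UNIV)
      fix S assume "S \<in> range C"
      then show "closedin Met_TC.mtopology S \<and> Met_TC.mtopology interior_of S = {}"
        using closed no by auto
    qed auto
    then show False by (simp add: all)
  qed
  then obtain k where "interior (C k) \<noteq> {}" by blast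
  then obtain x where "x \<in> interior (C k)" by blast
  then obtain r where r: "0 < r" "cball x r \<subseteq> C k" unfolding mem_interior_cball by blast
  have "norm (T i) \<le> 2 * real k / r" for i
  proof (rule norm_blinfun_bound)
    fix y
    show "norm (T i y) \<le> 2 * real k / r * norm y"
    proof (cases "y = 0")
      case False
      let ?z = "(r / norm y) *\<^sub>R y"
      have "norm ?z = r" using False r(1) by simp
      then have "x + ?z \<in> cball x r" "x \<in> cball x r" using r(1) by (auto simp: dist_norm)
      then have "norm (T i (x + ?z)) \<le> real k" "norm (T i x) \<le> real k"
        using r(2) unfolding C_def by blast+
      moreover have "T i ?z = T i (x + ?z) - T i x" by (simp add: blinfun.bilinear_simps)
      ultimately have "norm (T i ?z) \<le> 2 * real k"
        by (smt (verit) norm_triangle_ineq4)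
      then show ?thesis using False r(1) by (simp add: blinfun.bilinear_simps field_simps)
    qed simp
  qed (use r in simp)
  then show ?thesis by blast
qed

lemma C0_semigroup_0: "C0_semigroup V \<Longrightarrow> V 0 = id_blinfun"
  by (simp add: C0_semigroup_def)

lemma C0_semigroup_add: "C0_semigroup V \<Longrightarrow> 0 \<le> s \<Longrightarrow> 0 \<le> t \<Longrightarrow> V (s + t) x = V s (V t x)"
  by (simp add: C0_semigroup_def)

lemma C0_semigroup_tendsto: "C0_semigroup V \<Longrightarrow> ((\<lambda>t. V t x) \<longlongrightarrow> x) (at_right 0)"
  by (simp add: C0_semigroup_def)

text \<open>
  Otherwise there are \<open>t\<^sub>n \<rightarrow> 0\<close> with unbounded \<open>\<parallel>V(t\<^sub>n)\<parallel>\<close>, although \<open>V(t\<^sub>n)x \<rightarrow> x\<close> for all \<open>x\<close>.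
\<close>
lemma C0_semigroup_bounded_near_0:
  assumes V: "C0_semigroup V"
  shows "\<exists>\<delta>>0. \<exists>c. \<forall>t\<in>{0..\<delta>}. norm (V t) \<le> c"
proof (rule ccontr)
  assume no: "\<not> ?thesis"
  have "\<exists>t\<in>{0..inverse (real (Suc n))}. real n + 1 < norm (V t)" for n
    using no by (metis inverse_positive_iff_positive not_le of_nat_0_less_iff zero_less_Suc)
  then obtain t where t: "\<And>n. t n \<in> {0..inverse (real (Suc n))}" "\<And>n. real n + 1 < norm (V (t n))"
    by metis
  have pos: "0 < t n" for n
  proof -
    have "t n \<noteq> 0" using t(2)[of n] norm_blinfun_id_le[where 'a='a] C0_semigroup_0[OF V]
      by (metis add.commute le_add_same_cancel1 not_le of_nat_0_le_iff order_trans)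
    then show ?thesis using t(1)[of n] by auto
  qed
  have "t \<longlonglongrightarrow> 0"
    by (rule tendsto_sandwich[OF _ _ tendsto_const LIMSEQ_inverse_real_of_nat])
      (use t(1) in \<open>auto intro: always_eventually\<close>)
  then have "filterlim t (at_right 0) sequentially"
    using pos by (intro tendsto_imp_filterlim_at_right always_eventually) auto
  then have "(\<lambda>n. V (t n) x) \<longlonglongrightarrow> x" for x
    by (rule filterlim_compose[OF C0_semigroup_tendsto[OF V]])
  then have "\<exists>c. \<forall>n. norm (V (t n) x) \<le> c" for x
    by (meson Bseq_def convergentI convergent_imp_Bseq)
  then obtain c where c: "\<And>n. norm (V (t n)) \<le> c"
    using uniform_boundedness[of "\<lambda>n. V (t n)"] by blast
  obtain n where "c \<le> real n" using real_arch_simple by blast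
  then show False using c[of n] t(2)[of n] by linarith
qed

lemma C0_semigroup_bounded:
  assumes V: "C0_semigroup V"
  shows "\<exists>c. \<forall>t\<in>{0..b}. norm (V t) \<le> c"
proof -
  obtain \<delta> c where \<delta>: "0 < \<delta>" and c: "\<And>t. t \<in> {0..\<delta>} \<Longrightarrow> norm (V t) \<le> c"
    using C0_semigroup_bounded_near_0[OF V] by metis
  have c0: "0 \<le> c" using order_trans[OF norm_ge_zero c[of 0]] \<delta> by simp
  have "\<exists>C. \<forall>t\<in>{0..real n * \<delta>}. norm (V t) \<le> C" for n
  proof (induction n)
    case 0
    then show ?case by (intro exI[of _ "norm (V 0)"]) auto
  next
    case (Suc n)
    then obtain C where C: "\<And>t. t \<in> {0..real n * \<delta>} \<Longrightarrow> norm (V t) \<le> C" by blast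
    have "norm (V t) \<le> max c (C * c)" if t: "t \<in> {0..real (Suc n) * \<delta>}" for t
    proof (cases "t \<le> \<delta>")
      case True then show ?thesis using c[of t] t by auto
    next
      case False
      then have "V t = V (t - \<delta>) o\<^sub>L V \<delta>"
        using C0_semigroup_add[OF V, of "t - \<delta>" \<delta>] \<delta> by (intro blinfun_eqI) simp
      moreover have "norm (V (t - \<delta>)) \<le> C" using t False by (intro C) (auto simp: algebra_simps)
      moreover have "norm (V \<delta>) \<le> c" using c[of \<delta>] \<delta> by simp
      ultimately have "norm (V t) \<le> C * c"
        by (simp only: norm_compose_le)
      then show ?thesis by simp
    qed
    then show ?case by blast
  qed
  moreover obtain n where "b \<le> real n * \<delta>" using reals_Archimedean3[OF \<delta>] less_imp_le by blast
  ultimately show ?thesis by (meson atLeastAtMost_iff order_trans)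
qed

text \<open>
  Continuity from the left needs the local bound: \<open>V(r)x - V(s)x = V(r)(x - V(s - r)x)\<close> for \<open>r < s\<close>,
  where the operator \<open>V(r)\<close> varies.
\<close>
lemma C0_semigroup_continuous:
  assumes V: "C0_semigroup V"
  shows "continuous_on {0..b} (\<lambda>s. V s x)"
proof -
  obtain c' where c': "\<And>t. t \<in> {0..b} \<Longrightarrow> norm (V t) \<le> c'" using C0_semigroup_bounded[OF V] by blast
  define c where "c = \<bar>c'\<bar> + 1"
  have c: "norm (V t) \<le> c" if "t \<in> {0..b}" for t using c'[OF that] by (simp add: c_def)
  have c0: "0 < c" by (simp add: c_def)
  show ?thesis
    unfolding continuous_on_iff
  proof (intro ballI allI impI)
    fix s e :: real assume s: "s \<in> {0..b}" and e: "0 < e"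
    have "eventually (\<lambda>h. dist (V h x) x < e / c) (at_right 0)"
      using tendstoD[OF C0_semigroup_tendsto[OF V, of x], of "e / c"] e c0 by simp
    then obtain d where d: "0 < d" "\<And>h. 0 < h \<Longrightarrow> h < d \<Longrightarrow> dist (V h x) x < e / c"
      by (auto simp: eventually_at_right_field)
    have key: "dist (V r' x) (V r x) < e" if "r \<in> {0..b}" "r \<le> r'" "r' < r + d" for r r'
    proof (cases "r = r'")
      case False
      then have h: "0 < r' - r" "r' - r < d" using that by auto
      have "V r' x - V r x = V r (V (r' - r) x - x)"
        using C0_semigroup_add[OF V, of r "r' - r" x] that by (simp add: blinfun.bilinear_simps)
      then have "norm (V r' x - V r x) \<le> norm (V r) * norm (V (r' - r) x - x)"
        by (simp add: norm_blinfun)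
      also have "\<dots> \<le> c * norm (V (r' - r) x - x)" by (intro mult_right_mono c that) auto
      also have "\<dots> < c * (e / c)"
        using d(2)[OF h] c0 by (intro mult_strict_left_mono) (auto simp: dist_norm)
      finally show ?thesis using c0 by (simp add: dist_norm)
    qed (use e in simp)
    show "\<exists>d>0. \<forall>r\<in>{0..b}. dist r s < d \<longrightarrow> dist (V r x) (V s x) < e"
    proof (intro exI[of _ d] conjI d(1) ballI impI)
      fix r assume r: "r \<in> {0..b}" "dist r s < d"
      show "dist (V r x) (V s x) < e"
      proof (cases "s \<le> r")
        case True then show ?thesis using key[OF s, of r] r by (auto simp: dist_real_def)
      next
        case False then show ?thesis using key[OF r(1), of s] r by (auto simp: dist_real_def dist_commute)
      qed
    qed
  qed
qed

lemma C0_semigroup_generator_commute: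
  assumes V: "C0_semigroup V" and gen: "has_generator V D A" and x: "x \<in> D" and s: "0 \<le> s"
  shows "V s x \<in> D" and "A (V s x) = V s (A x)"
    and "((\<lambda>h. (V (s + h) x - V s x) /\<^sub>R h) \<longlongrightarrow> A (V s x)) (at_right 0)"
proof -
  have D: "D = {x. \<exists>y. ((\<lambda>h. (V h x - x) /\<^sub>R h) \<longlongrightarrow> y) (at_right 0)}"
    and lim: "\<And>x. x \<in> D \<Longrightarrow> ((\<lambda>h. (V h x - x) /\<^sub>R h) \<longlongrightarrow> A x) (at_right 0)"
    using gen by (simp_all add: has_generator_def)
  have l: "((\<lambda>h. V s ((V h x - x) /\<^sub>R h)) \<longlongrightarrow> V s (A x)) (at_right 0)"
    by (intro tendsto_intros lim x)
  have eq: "\<forall>\<^sub>F h in at_right 0. V s ((V h x - x) /\<^sub>R h) = (V (s + h) x - V s x) /\<^sub>R h"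
    using eventually_at_right_less[of "0::real"]
    by eventually_elim (simp add: blinfun.bilinear_simps C0_semigroup_add[OF V s])
  have eq2: "\<forall>\<^sub>F h in at_right 0. V s ((V h x - x) /\<^sub>R h) = (V h (V s x) - V s x) /\<^sub>R h"
    using eventually_at_right_less[of "0::real"]
  proof eventually_elim
    case (elim h)
    then have "V s (V h x) = V h (V s x)"
      using C0_semigroup_add[OF V s, of h x] C0_semigroup_add[OF V _ s, of h x] by (simp add: add.commute)
    then show ?case by (simp add: blinfun.bilinear_simps)
  qed
  have l2: "((\<lambda>h. (V h (V s x) - V s x) /\<^sub>R h) \<longlongrightarrow> V s (A x)) (at_right 0)"
    by (rule Lim_transform_eventually[OF l eq2])
  then show inD: "V s x \<in> D" using D by blast
  show A: "A (V s x) = V s (A x)"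
    by (rule tendsto_unique[OF _ lim[OF inD] l2]) simp
  show "((\<lambda>h. (V (s + h) x - V s x) /\<^sub>R h) \<longlongrightarrow> A (V s x)) (at_right 0)"
    unfolding A by (rule Lim_transform_eventually[OF l eq])
qed

text \<open>
  Orbits of a semigroup are differentiable from the right by definition, which is why a one-sided
  version of the monotonicity criterion is needed. If \<open>f b > f a\<close>, then for some \<open>\<epsilon> > 0\<close> the last
  point at which \<open>f s \<le> f a + \<epsilon>(s - a)\<close> lies before \<open>b\<close>, and there the right derivative is at
  least \<open>\<epsilon>\<close>.
\<close>
lemma right_derivative_nonpos_imp_le:
  fixes f :: "real \<Rightarrow> real"
  assumes cont: "continuous_on {a..b} f" and "a \<le> b"
    and der: "\<And>s. s \<in> {a..<b} \<Longrightarrow> ((\<lambda>h. (f (s + h) - f s) / h) \<longlongrightarrow> f' s) (at_right 0)"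
    and nonpos: "\<And>s. s \<in> {a..<b} \<Longrightarrow> f' s \<le> 0"
  shows "f b \<le> f a"
proof (rule ccontr)
  assume no: "\<not> f b \<le> f a"
  then have "a < b" using \<open>a \<le> b\<close> by (cases "a = b") auto
  \<comment> \<open>half the slope of the chord\<close>
  define \<epsilon> where "\<epsilon> = (f b - f a) / (2 * (b - a))"
  have \<epsilon>: "0 < \<epsilon>" using no \<open>a < b\<close> by (simp add: \<epsilon>_def)
  have "\<epsilon> * (b - a) = (f b - f a) / 2" using \<open>a < b\<close> by (simp add: \<epsilon>_def divide_simps)
  moreover have "f a + (f b - f a) / 2 < f b" using no by (simp add: field_simps)
  ultimately have fb: "f a + \<epsilon> * (b - a) < f b" by (simp only:)
  let ?A = "{a..b} \<inter> {s \<in> {a..b}. f s - \<epsilon> * (s - a) \<le> f a}"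
  have "closed {s \<in> {a..b}. f s - \<epsilon> * (s - a) \<le> f a}"
    by (intro continuous_on_closed_Collect_le continuous_intros cont)
  then have "compact ?A" by (intro compact_Int_closed) auto
  moreover have "a \<in> ?A" using \<open>a < b\<close> by simp
  then have "?A \<noteq> {}" by blast
  ultimately obtain s where s: "s \<in> ?A" "\<And>r. r \<in> ?A \<Longrightarrow> r \<le> s"
    using compact_attains_sup[of ?A] by blast
  have "s \<noteq> b" using s(1) fb by auto
  then have sb: "s \<in> {a..<b}" using s(1) by auto
  have "\<forall>\<^sub>F h in at_right 0. (f (s + h) - f s) / h < \<epsilon>"
    using order_tendstoD(2)[OF der[OF sb], of \<epsilon>] nonpos[OF sb] \<epsilon> by auto
  moreover have "\<forall>\<^sub>F h in at_right 0. h < b - s"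
    unfolding eventually_at_right_field by (intro exI[of _ "b - s"]) (use sb in auto)
  ultimately have "\<forall>\<^sub>F h in at_right 0. 0 < h \<and> h < b - s \<and> (f (s + h) - f s) / h < \<epsilon>"
    using eventually_at_right_less[of "0::real"] by eventually_elim auto
  then obtain h where h: "0 < h" "h < b - s" "(f (s + h) - f s) / h < \<epsilon>"
    using eventually_happens'[of "at_right (0::real)"] by auto
  then have "f (s + h) - f s < \<epsilon> * h" by (simp add: divide_less_eq)
  then have "s + h \<in> ?A" using s(1) h by (auto simp: algebra_simps)
  then show False using s(2)[of "s + h"] h(1) by auto
qed

context nonneg_self_adjoint
begin

text \<open>
  The difference \<open>w\<close> of two orbits starting at \<open>x\<close> stays in \<open>D\<close>, and \<open>\<parallel>w\<parallel>\<^sup>2\<close> has right derivative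
  \<open>-2\<langle>w, Tw\<rangle> \<le> 0\<close>.
\<close>
lemma C0_semigroup_unique_on_domain:
  assumes U: "C0_semigroup U" "has_generator U D (\<lambda>x. - T x)"
    and V: "C0_semigroup V" "has_generator V D (\<lambda>x. - T x)"
    and x: "x \<in> D" and t: "0 \<le> t"
  shows "V t x = U t x"
proof -
  let ?w = "\<lambda>s. V s x - U s x"
  note gU = C0_semigroup_generator_commute[OF U x] and gV = C0_semigroup_generator_commute[OF V x]
  have "inner (?w t) (?w t) \<le> inner (?w 0) (?w 0)"
  proof (rule right_derivative_nonpos_imp_le[where f = "\<lambda>s. inner (?w s) (?w s)" and f' = "\<lambda>s. - 2 * inner (?w s) (T (?w s))"])
    show "continuous_on {0..t} (\<lambda>s. inner (?w s) (?w s))"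
      by (intro continuous_intros C0_semigroup_continuous U V)
    fix s assume s: "s \<in> {0..<t}"
    then have s0: "0 \<le> s" by simp
    have wD: "?w s \<in> D" using subspace_diff[OF subspace gV(1)[OF s0] gU(1)[OF s0]] .
    show "- 2 * inner (?w s) (T (?w s)) \<le> 0" using nonneg[OF wD] by simp
    have "((\<lambda>h. (V (s + h) x - V s x) /\<^sub>R h - (U (s + h) x - U s x) /\<^sub>R h) \<longlongrightarrow> - T (V s x) - - T (U s x)) (at_right 0)"
      by (intro tendsto_diff gU(3) gV(3) s0)
    then have q: "((\<lambda>h. (?w (s + h) - ?w s) /\<^sub>R h) \<longlongrightarrow> - T (?w s)) (at_right 0)"
      by (simp add: diff[OF gV(1)[OF s0] gU(1)[OF s0]] algebra_simps)
    \<comment> \<open>\<open>\<parallel>a\<parallel>\<^sup>2 - \<parallel>b\<parallel>\<^sup>2 = \<langle>a - b, 2b + (a - b)\<rangle>\<close>, divided by \<open>h\<close>\<close>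
    have "((\<lambda>h. inner ((?w (s + h) - ?w s) /\<^sub>R h) (2 *\<^sub>R ?w s + h *\<^sub>R ((?w (s + h) - ?w s) /\<^sub>R h)))
        \<longlongrightarrow> inner (- T (?w s)) (2 *\<^sub>R ?w s + 0 *\<^sub>R (- T (?w s)))) (at_right 0)"
      by (intro tendsto_intros q)
    moreover have "inner (- T (?w s)) (2 *\<^sub>R ?w s + 0 *\<^sub>R (- T (?w s))) = - 2 * inner (?w s) (T (?w s))"
      by (simp add: inner_commute)
    moreover have "\<forall>\<^sub>F h in at_right 0.
        inner ((?w (s + h) - ?w s) /\<^sub>R h) (2 *\<^sub>R ?w s + h *\<^sub>R ((?w (s + h) - ?w s) /\<^sub>R h))
        = (inner (?w (s + h)) (?w (s + h)) - inner (?w s) (?w s)) / h"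
      using eventually_at_right_less[of "0::real"]
    proof eventually_elim
      case (elim h)
      have "inner ((a - b) /\<^sub>R h) (2 *\<^sub>R b + h *\<^sub>R ((a - b) /\<^sub>R h)) = (inner a a - inner b b) / h" for a b :: 'a
        using elim by (simp add: inner_simps inner_commute field_simps)
      then show ?case .
    qed
    ultimately show "((\<lambda>h. (inner (?w (s + h)) (?w (s + h)) - inner (?w s) (?w s)) / h)
        \<longlongrightarrow> - 2 * inner (?w s) (T (?w s))) (at_right 0)"
      using Lim_transform_eventually by fastforce
  qed (rule t)
  also have "\<dots> = 0" by (simp add: C0_semigroup_0[OF U(1)] C0_semigroup_0[OF V(1)])
  finally have "inner (?w t) (?w t) = 0" by (intro antisym) auto
  then show ?thesis by simp
qed

lemma op_exp_eqI:
  assumes dense: "closure D = UNIV"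
    and U: "C0_semigroup U" "has_generator U D (\<lambda>x. - T x)" and t: "0 \<le> t"
  shows "op_exp D (\<lambda>x. - T x) t = U t"
  unfolding op_exp_def
proof (rule the_equality)
  show "\<exists>U'. C0_semigroup U' \<and> has_generator U' D (\<lambda>x. - T x) \<and> U t = U' t" using U by blast
  fix B assume "\<exists>V. C0_semigroup V \<and> has_generator V D (\<lambda>x. - T x) \<and> B = V t"
  then obtain V where V: "C0_semigroup V" "has_generator V D (\<lambda>x. - T x)" "B = V t" by blast
  have "closed {x. V t x = U t x}" by (intro closed_Collect_eq continuous_intros)
  moreover have "D \<subseteq> {x. V t x = U t x}"
    using C0_semigroup_unique_on_domain[OF U V(1,2) _ t] by blast
  ultimately have "closure D \<subseteq> {x. V t x = U t x}" by (rule closure_minimal[rotated])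
  then show "B = U t" using dense V(3) by (intro blinfun_eqI) auto
qed

end

section \<open>The limit semigroup and its generator\<close>

text \<open>
  With \<open>S = (1 - G)/\<tau>\<close>, the operator \<open>E\<close> is \<open>(e\<^sup>-\<^sup>t\<^sup>S - 1 + tS)(1 + S)\<^sup>-\<^sup>1\<close>. It is of first order in \<open>t\<close>,
  and of second order after one more resolvent, with constants independent of \<open>\<tau>\<close>. Its terms
  are continuous in the semigroup and the resolvent, so the bounds pass to the limit \<open>\<tau> \<rightarrow> 0\<close>.
\<close>
lemma poisson_resolvent_taylor:
  fixes G R :: "'a::{real_inner, banach} \<Rightarrow>\<^sub>L 'a"
  assumes G: "pos_contraction G" and \<tau>: "0 < \<tau>" and t: "0 \<le> t"
    and R: "(id_blinfun + (id_blinfun - G) /\<^sub>R \<tau>) o\<^sub>L R = id_blinfun"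
      "R o\<^sub>L (id_blinfun + (id_blinfun - G) /\<^sub>R \<tau>) = id_blinfun"
    and nR: "norm R \<le> 1"
  defines "E \<equiv> ((poisson_op G (t / \<tau>) - id_blinfun) o\<^sub>L R) + t *\<^sub>R (id_blinfun - R)"
  shows "norm E \<le> 4 * t" and "norm (E o\<^sub>L R) \<le> 4 * t\<^sup>2"
proof -
  let ?N = "id_blinfun - G" and ?P = "poisson_op G (t / \<tau>)"
  have n: "norm G \<le> 1" using G by (simp add: pos_contraction_def)
  have RN: "R o\<^sub>L ?N = \<tau> *\<^sub>R (id_blinfun - R)" and NR: "?N o\<^sub>L R = \<tau> *\<^sub>R (id_blinfun - R)"
  proof -
    have "R + (R o\<^sub>L ?N) /\<^sub>R \<tau> = id_blinfun" "R + (?N o\<^sub>L R) /\<^sub>R \<tau> = id_blinfun"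
      using R by (simp_all add: compose_simps)
    then have "(R o\<^sub>L ?N) /\<^sub>R \<tau> = id_blinfun - R" "(?N o\<^sub>L R) /\<^sub>R \<tau> = id_blinfun - R"
      by (simp_all add: algebra_simps)
    then show "R o\<^sub>L ?N = \<tau> *\<^sub>R (id_blinfun - R)" "?N o\<^sub>L R = \<tau> *\<^sub>R (id_blinfun - R)"
      using \<tau> by (metis less_irrefl scaleR_one scaleR_scaleR right_inverse)+
  qed
  have "R - (R o\<^sub>L G) = R - (G o\<^sub>L R)" using RN NR by (simp add: compose_simps)
  then have "R o\<^sub>L G = G o\<^sub>L R" by (rule diff_left_imp_eq)
  then have RP: "R o\<^sub>L ?P = ?P o\<^sub>L R" by (rule poisson_op_commute[OF n])
  have d: "norm (id_blinfun - R) \<le> 2"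
    using norm_triangle_ineq4[of id_blinfun R] nR norm_blinfun_id_le[where 'a='a] by linarith
  have s: "0 \<le> t / \<tau>" using t \<tau> by simp
  have "norm (R o\<^sub>L (id_blinfun - ?P)) \<le> t / \<tau> * norm (R o\<^sub>L ?N)"
    by (rule norm_compose_id_diff_poisson_op[OF n s])
  also have "\<dots> = t * norm (id_blinfun - R)" using \<tau> by (simp add: RN)
  also have "\<dots> \<le> t * 2" by (intro mult_left_mono d t)
  finally have 1: "norm (R o\<^sub>L (id_blinfun - ?P)) \<le> 2 * t" by simp
  have "E = t *\<^sub>R (id_blinfun - R) - (R o\<^sub>L (id_blinfun - ?P))"
    by (simp add: E_def compose_simps RP)
  then have "norm E \<le> norm (t *\<^sub>R (id_blinfun - R)) + norm (R o\<^sub>L (id_blinfun - ?P))"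
    by (simp only: norm_triangle_ineq4)
  also have "\<dots> \<le> t * 2 + 2 * t"
    using t 1 mult_left_mono[OF d t] by (intro add_mono) auto
  finally show "norm E \<le> 4 * t" by simp
  have RNx: "R (?N x) = ?N (R x)" "R (?P x) = ?P (R x)" for x
    using RN NR RP by (simp_all only: blinfun_apply_blinfun_compose[symmetric])
  have "(t / \<tau>) *\<^sub>R (?N o\<^sub>L R) = t *\<^sub>R (id_blinfun - R)" using \<tau> by (simp add: NR)
  then have "E = ((?P - id_blinfun + (t / \<tau>) *\<^sub>R ?N) o\<^sub>L R)" by (simp add: E_def compose_simps)
  moreover have "(?P - id_blinfun + (t / \<tau>) *\<^sub>R ?N) o\<^sub>L (R o\<^sub>L R)
      = (R o\<^sub>L R) o\<^sub>L (?P - id_blinfun + (t / \<tau>) *\<^sub>R ?N)"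
  proof (rule blinfun_eqI)
    fix x
    have "(?P - id_blinfun + (t / \<tau>) *\<^sub>R ?N) y = ?P y - y + (t / \<tau>) *\<^sub>R (?N y)" for y
      by (simp only: blinfun.add_left blinfun.diff_left blinfun.scaleR_left blinfun_apply_id_blinfun)
    then show "((?P - id_blinfun + (t / \<tau>) *\<^sub>R ?N) o\<^sub>L (R o\<^sub>L R)) x
      = ((R o\<^sub>L R) o\<^sub>L (?P - id_blinfun + (t / \<tau>) *\<^sub>R ?N)) x"
      by (simp only: blinfun_apply_blinfun_compose blinfun.add_right blinfun.diff_right blinfun.scaleR_right RNx)
  qed
  ultimately have "E o\<^sub>L R = (R o\<^sub>L R) o\<^sub>L (?P - id_blinfun + (t / \<tau>) *\<^sub>R ?N)"
    by (simp only: compose_assoc)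
  then have "norm (E o\<^sub>L R) \<le> (t / \<tau>)\<^sup>2 * norm ((R o\<^sub>L R) o\<^sub>L (?N o\<^sub>L ?N))"
    using norm_compose_poisson_op_taylor1[OF n s, of "R o\<^sub>L R"] by simp
  also have "(R o\<^sub>L R) o\<^sub>L (?N o\<^sub>L ?N) = (R o\<^sub>L ?N) o\<^sub>L (R o\<^sub>L ?N)"
    by (rule blinfun_eqI) (simp only: blinfun_apply_blinfun_compose RNx)
  also have "norm \<dots> = \<tau>\<^sup>2 * norm ((id_blinfun - R) o\<^sub>L (id_blinfun - R))"
    unfolding RN by (simp add: bounded_bilinear.scaleR_left[OF bounded_bilinear_blinfun_compose]
        bounded_bilinear.scaleR_right[OF bounded_bilinear_blinfun_compose] power2_eq_square abs_mult)
  also have "(t / \<tau>)\<^sup>2 * (\<tau>\<^sup>2 * norm ((id_blinfun - R) o\<^sub>L (id_blinfun - R)))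
      = t\<^sup>2 * norm ((id_blinfun - R) o\<^sub>L (id_blinfun - R))"
    using \<tau> by (simp add: power_divide)
  also have "\<dots> \<le> t\<^sup>2 * (2 * 2)" by (intro mult_left_mono norm_compose_le d) auto
  finally show "norm (E o\<^sub>L R) \<le> 4 * t\<^sup>2" by simp
qed

lemma tendsto_zero_of_dense:
  fixes E :: "real \<Rightarrow> 'a::real_normed_vector \<Rightarrow>\<^sub>L 'b::real_normed_vector"
  assumes dense: "closure D = UNIV" and bd: "\<And>h. 0 < h \<Longrightarrow> norm (E h) \<le> c"
    and lim: "\<And>x. x \<in> D \<Longrightarrow> ((\<lambda>h. E h x) \<longlongrightarrow> 0) (at_right 0)"
  shows "((\<lambda>h. E h x) \<longlongrightarrow> 0) (at_right 0)"
proof (rule tendstoI)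
  fix e :: real assume e: "0 < e"
  have c: "0 \<le> c" using order_trans[OF norm_ge_zero bd[of 1]] by simp
  obtain y where y: "y \<in> D" "dist y x < e / (2 * (c + 1))"
    using dense closure_approachable[of x D] e c by (metis UNIV_I add_nonneg_pos divide_pos_pos mult_pos_pos zero_less_numeral zero_less_one)
  have "\<forall>\<^sub>F h in at_right 0. dist (E h y) 0 < e / 2" by (rule tendstoD[OF lim[OF y(1)]]) (use e in simp)
  then show "\<forall>\<^sub>F h in at_right 0. dist (E h x) 0 < e"
    using eventually_at_right_less[of "0::real"]
  proof eventually_elim
    case (elim h)
    have "norm (E h (x - y)) \<le> norm (E h) * norm (x - y)" by (rule norm_blinfun)
    also have "\<dots> \<le> (c + 1) * (e / (2 * (c + 1)))"
      using y(2) bd[of h] elim c by (intro mult_mono) (auto simp: dist_norm norm_minus_commute)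
    also have "\<dots> = e / 2" using c by (simp add: divide_simps)
    finally have "norm (E h (x - y)) \<le> e / 2" .
    moreover have "E h x = E h y + E h (x - y)" by (simp add: blinfun.bilinear_simps)
    ultimately show ?case
      using elim norm_triangle_ineq[of "E h y" "E h (x - y)"] by simp
  qed
qed

lemma is_operator_UNIV_iff:
  fixes A :: "'a::complex_inner \<Rightarrow>\<^sub>L 'a"
  shows "is_operator UNIV (blinfun_apply A) \<longleftrightarrow> (\<forall>c x. A (c *\<^sub>C x) = c *\<^sub>C A x)"
  by (auto simp: is_operator_def blinfun.bilinear_simps)

lemma bounded_linear_scaleC: "bounded_linear (\<lambda>x::'a::complex_inner. c *\<^sub>C x)"
proof (rule bounded_linear_intro[where K = "cmod c"])
  show "c *\<^sub>C (r *\<^sub>R x) = r *\<^sub>R c *\<^sub>C x" for r and x :: 'a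
    by (simp add: scaleR_scaleC scaleC_scaleC mult.commute)
  show "norm (c *\<^sub>C x) \<le> norm x * cmod c" for x :: 'a
  proof -
    have "(norm (c *\<^sub>C x))\<^sup>2 = Re ((cnj c * c) * cinner x x)"
      by (simp add: power2_norm_eq_inner inner_eq_Re_cinner cinner_scaleC_left cinner_scaleC_right mult.assoc mult.left_commute)
    also have "cnj c * c = complex_of_real ((cmod c)\<^sup>2)"
      by (metis complex_norm_square mult.commute)
    also have "Re (complex_of_real ((cmod c)\<^sup>2) * cinner x x) = (norm x * cmod c)\<^sup>2"
      by (simp add: power2_norm_eq_inner inner_eq_Re_cinner power_mult_distrib)
    finally show ?thesis by (simp add: power2_eq_iff_nonneg)
  qed
qed (simp add: scaleC_add_right)

lemma is_operator_UNIV_iff_commute: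
  fixes A :: "'a::complex_inner \<Rightarrow>\<^sub>L 'a"
  shows "is_operator UNIV (blinfun_apply A)
    \<longleftrightarrow> (\<forall>c. Blinfun (\<lambda>x. c *\<^sub>C x) o\<^sub>L A = A o\<^sub>L Blinfun (\<lambda>x. c *\<^sub>C x))"
proof -
  let ?J = "\<lambda>c. Blinfun (\<lambda>x::'a. c *\<^sub>C x)"
  have J: "?J c x = c *\<^sub>C x" for c x
    by (simp add: bounded_linear_Blinfun_apply[OF bounded_linear_scaleC])
  have "?J c o\<^sub>L A = A o\<^sub>L ?J c \<longleftrightarrow> (\<forall>x. A (c *\<^sub>C x) = c *\<^sub>C A x)" for c
  proof
    assume "?J c o\<^sub>L A = A o\<^sub>L ?J c"
    then have "(?J c o\<^sub>L A) x = (A o\<^sub>L ?J c) x" for x by simp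
    then show "\<forall>x. A (c *\<^sub>C x) = c *\<^sub>C A x" by (simp add: J)
  qed (auto intro!: blinfun_eqI simp: J)
  then show ?thesis unfolding is_operator_UNIV_iff by blast
qed

text \<open>
  Norm resolvent convergence at rate \<open>\<tau>\<close> of the bounded operators \<open>(1 - F(\<tau>))/\<tau>\<close> to \<open>H\<close>. The
  operators \<open>approx \<tau> t\<close> below are their semigroups at time \<open>t\<close>.
\<close>
locale resolvent_approximation = nonneg_self_adjoint D H
  for D :: "'a::chilbert_space set" and H :: "'a \<Rightarrow> 'a" +
  fixes F :: "real \<Rightarrow> 'a \<Rightarrow>\<^sub>L 'a" and M :: real
  assumes dense: "closure D = UNIV"
    and pos_contraction: "0 < \<tau> \<Longrightarrow> pos_contraction (F \<tau>)"
    and linear: "0 < \<tau> \<Longrightarrow> is_operator UNIV (F \<tau>)"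
    and bound: "0 < \<tau> \<Longrightarrow> \<tau> \<le> 1 \<Longrightarrow>
      norm (bounded_inverse UNIV (id_blinfun + (id_blinfun - F \<tau>) /\<^sub>R \<tau>) - resolvent) \<le> M * \<tau>"
begin

definition approx :: "real \<Rightarrow> real \<Rightarrow> 'a \<Rightarrow>\<^sub>L 'a" where
  "approx \<tau> t = poisson_op (F \<tau>) (t / \<tau>)"

definition approx_resolvent :: "real \<Rightarrow> 'a \<Rightarrow>\<^sub>L 'a" where
  "approx_resolvent \<tau> = bounded_inverse UNIV (id_blinfun + (id_blinfun - F \<tau>) /\<^sub>R \<tau>)"

lemma norm_F_le: "0 < \<tau> \<Longrightarrow> norm (F \<tau>) \<le> 1"
  and symmetric_F: "0 < \<tau> \<Longrightarrow> symmetric_op (F \<tau>)"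
  using pos_contraction by (simp_all add: pos_contraction_def)

lemma approx_resolvent:
  assumes \<tau>: "0 < \<tau>"
  shows "(id_blinfun + (id_blinfun - F \<tau>) /\<^sub>R \<tau>) o\<^sub>L approx_resolvent \<tau> = id_blinfun"
    and "approx_resolvent \<tau> o\<^sub>L (id_blinfun + (id_blinfun - F \<tau>) /\<^sub>R \<tau>) = id_blinfun"
    and "norm (approx_resolvent \<tau>) \<le> 1"
proof -
  let ?S = "(id_blinfun - F \<tau>) /\<^sub>R \<tau>"
  interpret S: nonneg_self_adjoint UNIV ?S
  proof (rule nonneg_self_adjoint_blinfun)
    show "inner (?S x) y = inner x (?S y)" for x y
      by (simp add: blinfun.bilinear_simps inner_simps symmetric_opD[OF symmetric_F[OF \<tau>]])
    show "0 \<le> inner x (?S x)" for x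
      using pos_contraction_le[OF norm_F_le[OF \<tau>], of x] \<tau>
      by (simp add: blinfun.bilinear_simps inner_simps inner_commute)
  qed
  have "blinfun_apply (id_blinfun + ?S) = (\<lambda>x. x + ?S x)" by (auto simp: blinfun.bilinear_simps)
  then have eq: "approx_resolvent \<tau> = S.resolvent"
    by (simp add: approx_resolvent_def S.resolvent_def)
  show "(id_blinfun + ?S) o\<^sub>L approx_resolvent \<tau> = id_blinfun"
    unfolding eq by (rule blinfun_eqI)
      (simp only: blinfun_apply_blinfun_compose blinfun.add_left blinfun_apply_id_blinfun S.one_plus_resolvent)
  show "approx_resolvent \<tau> o\<^sub>L (id_blinfun + ?S) = id_blinfun"
    unfolding eq by (rule blinfun_eqI)
      (simp only: blinfun_apply_blinfun_compose blinfun.add_left blinfun_apply_id_blinfun S.resolvent_one_plus UNIV_I)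
  show "norm (approx_resolvent \<tau>) \<le> 1" unfolding eq by (rule S.norm_resolvent_le)
qed

lemma approx_diff_le:
  assumes \<tau>: "0 < \<tau>" "\<tau> \<le> 1" and \<sigma>: "0 < \<sigma>" "\<sigma> \<le> 1" and t: "0 < t"
  shows "norm (approx \<tau> t - approx \<sigma> t) \<le> 22 * exp t * (M * \<tau> + M * \<sigma>) / t"
proof -
  have "norm (approx_resolvent \<tau> - approx_resolvent \<sigma>)
      \<le> norm (approx_resolvent \<tau> - resolvent) + norm (approx_resolvent \<sigma> - resolvent)"
    using norm_triangle_ineq4[of "approx_resolvent \<tau> - resolvent" "approx_resolvent \<sigma> - resolvent"] by simp
  also have "\<dots> \<le> M * \<tau> + M * \<sigma>"
    using bound[OF \<tau>] bound[OF \<sigma>] by (simp add: approx_resolvent_def)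
  finally have "22 * exp t * norm (approx_resolvent \<tau> - approx_resolvent \<sigma>) / t
      \<le> 22 * exp t * (M * \<tau> + M * \<sigma>) / t"
    using t by (intro divide_right_mono mult_left_mono) auto
  then show ?thesis
    using poisson_op_resolvent_compare[OF pos_contraction[OF \<tau>(1)] \<tau>(1) approx_resolvent(1,2)[OF \<tau>(1)]
        pos_contraction[OF \<sigma>(1)] \<sigma>(1) approx_resolvent(1,2)[OF \<sigma>(1)] t]
    unfolding approx_def by linarith
qed

text \<open>
  A sequence of admissible \<open>\<tau>\<close> tending to \<open>0\<close>, along which the semigroup is defined as a limit.
\<close>
definition step :: "nat \<Rightarrow> real" where "step m = inverse (real (Suc m))"

lemma step: "0 < step m" "step m \<le> 1" "step \<longlonglongrightarrow> 0"
  unfolding step_def[abs_def] using LIMSEQ_inverse_real_of_nat by (auto simp: field_simps)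

definition heat :: "real \<Rightarrow> 'a \<Rightarrow>\<^sub>L 'a" where
  "heat t = lim (\<lambda>m. approx (step m) t)"

lemma approx_tendsto_heat:
  assumes "0 \<le> t" shows "(\<lambda>m. approx (step m) t) \<longlonglongrightarrow> heat t"
proof (cases "t = 0")
  case True
  then show ?thesis by (simp add: heat_def approx_def)
next
  case False
  then have t: "0 < t" using assms by simp
  let ?b = "\<lambda>m n. 22 * exp t * (M * step m + M * step n) / t"
  have "Cauchy (\<lambda>m. approx (step m) t)"
  proof (rule metric_CauchyI)
    fix e :: real assume e: "0 < e"
    have "(\<lambda>m. 22 * exp t * (M * step m) / t) \<longlonglongrightarrow> 22 * exp t * (M * 0) / t"
      using t by (intro tendsto_intros step(3)) auto
    then have "\<forall>\<^sub>F m in sequentially. 22 * exp t * (M * step m) / t < e / 2"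
      by (rule order_tendstoD(2)) (use e in simp)
    then obtain N where N: "\<And>m. N \<le> m \<Longrightarrow> 22 * exp t * (M * step m) / t < e / 2"
      unfolding eventually_sequentially by blast
    have "dist (approx (step m) t) (approx (step n) t) < e" if "N \<le> m" "N \<le> n" for m n
    proof -
      have "?b m n = 22 * exp t * (M * step m) / t + 22 * exp t * (M * step n) / t"
        by (simp add: algebra_simps add_divide_distrib)
      then show ?thesis
        using approx_diff_le[OF step(1,2) step(1,2) t, of m n] N[OF that(1)] N[OF that(2)]
        unfolding dist_norm by linarith
    qed
    then show "\<exists>K. \<forall>m\<ge>K. \<forall>n\<ge>K. dist (approx (step m) t) (approx (step n) t) < e" by blast
  qed
  then show ?thesis unfolding heat_def by (simp add: Cauchy_convergent_iff convergent_LIMSEQ_iff)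
qed

lemma approx_heat_le:
  assumes \<tau>: "0 < \<tau>" "\<tau> \<le> 1" and t: "0 < t"
  shows "norm (approx \<tau> t - heat t) \<le> 22 * exp t * M * \<tau> / t"
proof (rule LIMSEQ_le)
  show "(\<lambda>m. norm (approx \<tau> t - approx (step m) t)) \<longlonglongrightarrow> norm (approx \<tau> t - heat t)"
    using t by (intro tendsto_intros approx_tendsto_heat) auto
  have "(\<lambda>m. 22 * exp t * (M * \<tau> + M * step m) / t) \<longlonglongrightarrow> 22 * exp t * (M * \<tau> + M * 0) / t"
    using t by (intro tendsto_intros step(3)) auto
  then show "(\<lambda>m. 22 * exp t * (M * \<tau> + M * step m) / t) \<longlonglongrightarrow> 22 * exp t * M * \<tau> / t"
    by (simp add: ac_simps)
qed (use approx_diff_le[OF \<tau> step(1,2) t] in blast)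

lemma heat_0: "heat 0 = id_blinfun"
  by (simp add: heat_def approx_def)

lemma norm_heat_le:
  assumes "0 \<le> t" shows "norm (heat t) \<le> 1"
proof (rule LIMSEQ_le_const2[OF tendsto_norm[OF approx_tendsto_heat[OF assms]]])
  have "norm (approx (step m) t) \<le> 1" for m
    unfolding approx_def
    by (rule norm_poisson_op_le[OF norm_F_le]) (use step(1)[of m] assms in simp_all)
  then show "\<exists>N. \<forall>m\<ge>N. norm (approx (step m) t) \<le> 1" by blast
qed

lemma heat_add:
  assumes "0 \<le> s" "0 \<le> t" shows "heat (s + t) = heat s o\<^sub>L heat t"
proof (rule LIMSEQ_unique[OF approx_tendsto_heat])
  have "(\<lambda>m. approx (step m) s o\<^sub>L approx (step m) t) \<longlonglongrightarrow> (heat s o\<^sub>L heat t)"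
    by (intro bounded_bilinear.tendsto[OF bounded_bilinear_blinfun_compose] approx_tendsto_heat assms)
  then show "(\<lambda>m. approx (step m) (s + t)) \<longlonglongrightarrow> (heat s o\<^sub>L heat t)"
    by (simp add: approx_def add_divide_distrib poisson_op_add norm_F_le step)
qed (use assms in simp)

lemma symmetric_heat:
  assumes "0 \<le> t" shows "inner (heat t x) y = inner x (heat t y)"
proof (rule LIMSEQ_unique)
  show "(\<lambda>m. inner (approx (step m) t x) y) \<longlonglongrightarrow> inner (heat t x) y"
    by (intro tendsto_intros approx_tendsto_heat assms)
  have "(\<lambda>m. inner x (approx (step m) t y)) \<longlonglongrightarrow> inner x (heat t y)"
    by (intro tendsto_intros approx_tendsto_heat assms)
  then show "(\<lambda>m. inner (approx (step m) t x) y) \<longlonglongrightarrow> inner x (heat t y)"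
    using symmetric_opD[OF symmetric_poisson_op[OF norm_F_le symmetric_F]] by (simp add: approx_def step)
qed

text \<open>
  Complex linearity, as commutation with scalar multiplications, is inherited from \<open>F(\<tau>)\<close> and
  preserved by norm limits.
\<close>
lemma is_operator_heat:
  assumes "0 \<le> t" shows "is_operator UNIV (heat t)"
  unfolding is_operator_UNIV_iff_commute
proof
  fix c
  let ?J = "Blinfun (\<lambda>x::'a. c *\<^sub>C x)"
  have comm: "?J o\<^sub>L F \<tau> = F \<tau> o\<^sub>L ?J" if "0 < \<tau>" for \<tau>
    using linear[OF that] unfolding is_operator_UNIV_iff_commute by blast
  have c: "?J o\<^sub>L approx (step m) t = approx (step m) t o\<^sub>L ?J" for m
    unfolding approx_def by (rule poisson_op_commute[OF norm_F_le[OF step(1)] comm[OF step(1)]])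
  show "?J o\<^sub>L heat t = heat t o\<^sub>L ?J"
  proof (rule LIMSEQ_unique)
    show "(\<lambda>m. ?J o\<^sub>L approx (step m) t) \<longlonglongrightarrow> (?J o\<^sub>L heat t)"
      by (intro bounded_bilinear.tendsto[OF bounded_bilinear_blinfun_compose] tendsto_const
          approx_tendsto_heat assms)
    show "(\<lambda>m. ?J o\<^sub>L approx (step m) t) \<longlonglongrightarrow> (heat t o\<^sub>L ?J)"
      unfolding c by (intro bounded_bilinear.tendsto[OF bounded_bilinear_blinfun_compose] tendsto_const
          approx_tendsto_heat assms)
  qed
qed

lemma heat_resolvent_taylor:
  assumes t: "0 \<le> t"
  defines "E \<equiv> ((heat t - id_blinfun) o\<^sub>L resolvent) + t *\<^sub>R (id_blinfun - resolvent)"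
  shows "norm E \<le> 4 * t" and "norm (E o\<^sub>L resolvent) \<le> 4 * t\<^sup>2"
proof -
  define E' where "E' m = ((approx (step m) t - id_blinfun) o\<^sub>L approx_resolvent (step m))
    + t *\<^sub>R (id_blinfun - approx_resolvent (step m))" for m
  have "(\<lambda>m. approx_resolvent (step m) - resolvent) \<longlonglongrightarrow> 0"
  proof (rule tendsto_norm_zero_cancel, rule tendsto_sandwich[OF _ _ tendsto_const])
    show "(\<lambda>m. M * step m) \<longlonglongrightarrow> 0" using tendsto_mult_right_zero[OF step(3)] .
  qed (use bound[OF step(1,2)] in \<open>auto simp: approx_resolvent_def\<close>)
  then have R: "(\<lambda>m. approx_resolvent (step m)) \<longlonglongrightarrow> resolvent" by (simp add: LIM_zero_iff)
  have E: "E' \<longlonglongrightarrow> E"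
    unfolding E'_def[abs_def] E_def
    by (intro tendsto_intros bounded_bilinear.tendsto[OF bounded_bilinear_blinfun_compose] R
        approx_tendsto_heat t)
  then have ER: "(\<lambda>m. E' m o\<^sub>L approx_resolvent (step m)) \<longlonglongrightarrow> (E o\<^sub>L resolvent)"
    by (intro bounded_bilinear.tendsto[OF bounded_bilinear_blinfun_compose] R)
  note b = poisson_resolvent_taylor[OF pos_contraction step(1) t approx_resolvent, OF step(1) step(1) step(1) step(1)]
  show "norm E \<le> 4 * t"
    by (rule LIMSEQ_le_const2[OF tendsto_norm[OF E]]) (use b(1) in \<open>auto simp: E'_def approx_def\<close>)
  show "norm (E o\<^sub>L resolvent) \<le> 4 * t\<^sup>2"
    by (rule LIMSEQ_le_const2[OF tendsto_norm[OF ER]]) (use b(2) in \<open>auto simp: E'_def approx_def\<close>)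
qed

text \<open>
  For \<open>x = R y\<close> with the resolvent \<open>R\<close> of \<open>H\<close> at \<open>-1\<close>, one has \<open>Hx = y - Ry\<close>, and the difference
  quotient plus \<open>Hx\<close> is \<open>E(h)y/h\<close> with the operator \<open>E(h)\<close> of the Taylor bound. These operators are
  bounded by \<open>4\<close>, and tend to \<open>0\<close> on the dense range of \<open>R\<close>.
\<close>
lemma heat_derivative_at_0:
  assumes x: "x \<in> D"
  shows "((\<lambda>h. (heat h x - x) /\<^sub>R h) \<longlongrightarrow> - H x) (at_right 0)"
proof -
  define E where "E h = ((heat h - id_blinfun) o\<^sub>L resolvent) + h *\<^sub>R (id_blinfun - resolvent)" for h
  have E: "norm (E h) \<le> 4 * h" "norm (E h o\<^sub>L resolvent) \<le> 4 * h\<^sup>2" if "0 < h" for h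
    using heat_resolvent_taylor[of h] that by (simp_all add: E_def)
  have "((\<lambda>h. (E h /\<^sub>R h) y) \<longlongrightarrow> 0) (at_right 0)" for y
  proof (rule tendsto_zero_of_dense[OF dense, where c = 4])
    show "norm (E h /\<^sub>R h) \<le> 4" if "0 < h" for h
      using E(1)[OF that] that by (simp add: field_simps)
    fix y assume "y \<in> D"
    then obtain z where y: "y = resolvent z" by (metis resolvent_one_plus)
    show "((\<lambda>h. (E h /\<^sub>R h) y) \<longlongrightarrow> 0) (at_right 0)"
    proof (rule tendsto_norm_zero_cancel, rule tendsto_sandwich[OF _ _ tendsto_const])
      show "((\<lambda>h::real. 4 * h * norm z) \<longlongrightarrow> 0) (at_right 0)"
        by (auto intro!: tendsto_eq_intros)
      show "\<forall>\<^sub>F h in at_right 0. norm ((E h /\<^sub>R h) y) \<le> 4 * h * norm z"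
        using eventually_at_right_less[of "0::real"]
      proof eventually_elim
        case (elim h)
        have "norm (E h y) \<le> norm (E h o\<^sub>L resolvent) * norm z"
          unfolding y using norm_blinfun[of "E h o\<^sub>L resolvent" z] by simp
        also have "\<dots> \<le> 4 * h\<^sup>2 * norm z" using E(2)[OF elim] by (intro mult_right_mono) auto
        finally show ?case using elim by (simp add: blinfun.bilinear_simps field_simps power2_eq_square)
      qed
    qed auto
  qed
  from tendsto_diff[OF this[of "x + H x"] tendsto_const[of "H x"]]
  have lim: "((\<lambda>h. (E h /\<^sub>R h) (x + H x) - H x) \<longlongrightarrow> - H x) (at_right 0)" by simp
  have "\<forall>\<^sub>F h in at_right 0. (E h /\<^sub>R h) (x + H x) - H x = (heat h x - x) /\<^sub>R h"
    using eventually_at_right_less[of "0::real"]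
  proof eventually_elim
    case (elim h)
    have "E h (x + H x) = (heat h x - x) + h *\<^sub>R H x"
      unfolding E_def blinfun.add_left blinfun.scaleR_left blinfun.diff_left blinfun_apply_blinfun_compose
        resolvent_one_plus[OF x] by simp
    then have "(E h /\<^sub>R h) (x + H x) = (heat h x - x) /\<^sub>R h + (h *\<^sub>R H x) /\<^sub>R h"
      by (simp only: blinfun.scaleR_left scaleR_add_right)
    then show ?case using elim by simp
  qed
  from Lim_transform_eventually[OF lim this] show ?thesis .
qed

lemma C0_semigroup_heat: "C0_semigroup heat"
  unfolding C0_semigroup_def
proof (intro conjI allI impI)
  fix x
  have "((\<lambda>h. (heat h - id_blinfun) x) \<longlongrightarrow> 0) (at_right 0)"
  proof (rule tendsto_zero_of_dense[OF dense, where c = 2])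
    show "norm (heat h - id_blinfun) \<le> 2" if "0 < h" for h
      using norm_triangle_ineq4[of "heat h" id_blinfun] norm_heat_le[of h] that
        norm_blinfun_id_le[where 'a='a] by linarith
    fix x assume "x \<in> D"
    have "((\<lambda>h. h *\<^sub>R ((heat h x - x) /\<^sub>R h)) \<longlongrightarrow> 0 *\<^sub>R (- H x)) (at_right 0)"
      by (intro tendsto_intros heat_derivative_at_0 \<open>x \<in> D\<close>)
    moreover have "\<forall>\<^sub>F h in at_right 0. h *\<^sub>R ((heat h x - x) /\<^sub>R h) = (heat h - id_blinfun) x"
      using eventually_at_right_less[of "0::real"] by eventually_elim (simp add: blinfun.bilinear_simps)
    ultimately show "((\<lambda>h. (heat h - id_blinfun) x) \<longlongrightarrow> 0) (at_right 0)"
      using Lim_transform_eventually by fastforce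
  qed
  then show "((\<lambda>h. heat h x) \<longlongrightarrow> x) (at_right 0)"
    by (simp add: blinfun.bilinear_simps LIM_zero_iff)
qed (use is_operator_heat heat_0 heat_add in auto)

text \<open>
  If the difference quotient at \<open>x\<close> converges to \<open>z\<close>, then symmetry of the semigroup gives
  \<open>\<langle>x, Hv\<rangle> = \<langle>-z, v\<rangle>\<close> for all \<open>v \<in> D\<close>, so \<open>x\<close> lies in the domain of the adjoint of \<open>H\<close>, which is \<open>D\<close>.
\<close>
lemma has_generator_heat: "has_generator heat D (\<lambda>x. - H x)"
  unfolding has_generator_def
proof (intro conjI ballI heat_derivative_at_0)
  have "x \<in> D" if z: "((\<lambda>h. (heat h x - x) /\<^sub>R h) \<longlongrightarrow> z) (at_right 0)" for x z
  proof -
    have "inner x (H v) = inner (- z) v" if v: "v \<in> D" for v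
    proof -
      have "((\<lambda>h. inner ((heat h x - x) /\<^sub>R h) v) \<longlongrightarrow> inner z v) (at_right 0)"
        by (intro tendsto_intros z)
      moreover have "\<forall>\<^sub>F h in at_right 0. inner ((heat h x - x) /\<^sub>R h) v = inner x ((heat h v - v) /\<^sub>R h)"
        using eventually_at_right_less[of "0::real"]
        by eventually_elim (simp add: inner_simps symmetric_heat)
      ultimately have "((\<lambda>h. inner x ((heat h v - v) /\<^sub>R h)) \<longlongrightarrow> inner z v) (at_right 0)"
        by (rule Lim_transform_eventually)
      moreover have "((\<lambda>h. inner x ((heat h v - v) /\<^sub>R h)) \<longlongrightarrow> inner x (- H v)) (at_right 0)"
        by (intro tendsto_intros heat_derivative_at_0 v)
      ultimately have "inner z v = inner x (- H v)"
        using tendsto_unique[OF trivial_limit_at_right_real] by blast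
      then show ?thesis by simp
    qed
    then show ?thesis using adjoint_iff[of x "- z"] by blast
  qed
  then show "D = {x. \<exists>y. ((\<lambda>h. (heat h x - x) /\<^sub>R h) \<longlongrightarrow> y) (at_right 0)}"
    using heat_derivative_at_0 by blast
qed

end

section \<open>The rate of convergence\<close>

theorem theorem3p6:
  fixes F :: "real \<Rightarrow> 'a::chilbert_space \<Rightarrow>\<^sub>L 'a"
    and S :: "real \<Rightarrow> 'a \<Rightarrow>\<^sub>L 'a"
    and D :: "'a set"
    and H :: "'a \<Rightarrow> 'a"
    and M\<^sub>1 :: real
    and I :: "real set"
  assumes F_measurable: "measurable_family F"
    and F_self_adjoint: "\<And>t. t \<ge> 0 \<Longrightarrow> self_adjoint UNIV (blinfun_apply (F t))"
    and F_nonneg: "\<And>t. t \<ge> 0 \<Longrightarrow> nonneg_op UNIV (blinfun_apply (F t))"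
    and F_contraction: "\<And>t. t \<ge> 0 \<Longrightarrow> norm (F t) \<le> 1"
    and F_0: "F 0 = id_blinfun"
    and S_def: "\<And>\<tau>. \<tau> > 0 \<Longrightarrow> S \<tau> = (id_blinfun - F \<tau>) /\<^sub>R \<tau>"
    and H_self_adjoint: "self_adjoint D H"
    and H_nonneg: "nonneg_op D H"
    and s_lim: "\<And>x. ((\<lambda>\<tau>. bounded_inverse UNIV (id_blinfun + S \<tau>) x)
                  \<longlongrightarrow> bounded_inverse D (\<lambda>y. y + H y) x) (at_right 0)"
    and M\<^sub>1_pos: "M\<^sub>1 > 0"
    and resolvent_bound: "\<And>\<tau>. \<tau> \<in> {0<..1} \<Longrightarrow>
           norm (bounded_inverse UNIV (id_blinfun + S \<tau>)
                 - bounded_inverse D (\<lambda>y. y + H y)) \<le> M\<^sub>1 * \<tau>"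
    and I_interval: "is_interval I"
    and I_bounded: "bounded I"
    and I_nonneg: "I \<subseteq> {0..}"
  shows "\<exists>c>0. \<forall>n::nat. n \<ge> 1 \<longrightarrow>
           (SUP t\<in>I. ereal (norm (blinfun_power (F (t / real n)) n
                                   - op_exp D (\<lambda>x. - H x) t)))
           \<le> ereal (c * (1 / real n))"
proof -
  have nsa: "nonneg_self_adjoint UNIV (blinfun_apply (F t))" if "0 \<le> t" for t
    by (rule self_adjoint_imp_nonneg_self_adjoint[OF F_self_adjoint[OF that] F_nonneg[OF that]])
  have pc: "pos_contraction (F t)" if "0 \<le> t" for t
    using nonneg_self_adjoint.symmetric[OF nsa[OF that]] nonneg_self_adjoint.nonneg[OF nsa[OF that]]
      F_contraction[OF that]
    by (simp add: pos_contraction_def symmetric_op_def inner_commute)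
  interpret H: nonneg_self_adjoint D H
    by (rule self_adjoint_imp_nonneg_self_adjoint[OF H_self_adjoint H_nonneg])
  interpret H: resolvent_approximation D H F M\<^sub>1
  proof
    show "closure D = UNIV" using H_self_adjoint by (simp add: self_adjoint_def)
    fix \<tau> :: real assume \<tau>: "0 < \<tau>"
    show "pos_contraction (F \<tau>)" using pc \<tau> by simp
    show "is_operator UNIV (F \<tau>)" using F_self_adjoint[of \<tau>] \<tau> by (simp add: self_adjoint_def)
    show "norm (bounded_inverse UNIV (id_blinfun + (id_blinfun - F \<tau>) /\<^sub>R \<tau>) - H.resolvent) \<le> M\<^sub>1 * \<tau>"
      if "\<tau> \<le> 1"
      using resolvent_bound[of \<tau>] \<tau> that by (simp add: S_def[OF \<tau>] H.resolvent_def)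
  qed
  obtain T where T: "0 < T" "\<And>t. t \<in> I \<Longrightarrow> t \<le> T"
    using I_bounded unfolding bounded_pos by (metis abs_le_D1 real_norm_def)
  define c where "c = 16 + 22 * exp T * M\<^sub>1 + 2 * T"
  have c: "16 + 22 * exp T * M\<^sub>1 \<le> c" "2 * T \<le> c" "0 < c"
    using T(1) M\<^sub>1_pos by (simp_all add: c_def add_pos_pos)
  have main: "norm (blinfun_power (F (t / real n)) n - op_exp D (\<lambda>x. - H x) t) \<le> c * (1 / real n)"
    if n: "n \<ge> 1" and t: "t \<in> I" for n t
  proof -
    have t0: "0 \<le> t" and tT: "t \<le> T" using t I_nonneg T by auto
    have e: "op_exp D (\<lambda>x. - H x) t = H.heat t"
      by (rule H.op_exp_eqI[OF H.dense H.C0_semigroup_heat H.has_generator_heat t0])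
    let ?\<tau> = "t / real n"
    \<comment> \<open>the resolvent estimate is available for \<open>\<tau> \<le> 1\<close>; otherwise \<open>n < T\<close> and the trivial bound \<open>2\<close> is \<open>O(1/n)\<close>\<close>
    consider "t = 0" | "0 < t" "?\<tau> \<le> 1" | "1 < ?\<tau>" using t0 by fastforce
    then show ?thesis
    proof cases
      case 1
      have "blinfun_power id_blinfun n = (id_blinfun :: 'a \<Rightarrow>\<^sub>L 'a)" by (induction n) simp_all
      then show ?thesis unfolding e using 1 c(3) by (simp add: F_0 H.heat_0)
    next
      case 2
      have \<tau>: "0 < ?\<tau>" using 2(1) n by simp
      have "H.approx ?\<tau> t = poisson_op (F ?\<tau>) (real n)" using 2(1) by (simp add: H.approx_def)
      then have "norm (blinfun_power (F ?\<tau>) n - H.approx ?\<tau> t) \<le> 16 / real n"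
        using norm_power_diff_poisson_op_le[OF pc[OF less_imp_le[OF \<tau>]] n] by simp
      moreover have "norm (H.approx ?\<tau> t - H.heat t) \<le> 22 * exp t * M\<^sub>1 / real n"
        using H.approx_heat_le[OF \<tau> 2(2,1)] 2(1) by simp
      moreover have "22 * exp t * M\<^sub>1 / real n \<le> 22 * exp T * M\<^sub>1 / real n"
        using tT M\<^sub>1_pos by (intro divide_right_mono mult_right_mono) auto
      moreover have "norm (blinfun_power (F ?\<tau>) n - H.heat t)
          \<le> norm (blinfun_power (F ?\<tau>) n - H.approx ?\<tau> t) + norm (H.approx ?\<tau> t - H.heat t)"
        using norm_triangle_ineq[of "blinfun_power (F ?\<tau>) n - H.approx ?\<tau> t" "H.approx ?\<tau> t - H.heat t"]
        by simp
      ultimately have "norm (blinfun_power (F ?\<tau>) n - H.heat t) \<le> (16 + 22 * exp T * M\<^sub>1) / real n"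
        by (simp add: add_divide_distrib)
      also have "\<dots> \<le> c / real n" using c(1) by (intro divide_right_mono) auto
      finally show ?thesis by (simp add: e)
    next
      case 3
      have "norm (blinfun_power (F ?\<tau>) n - H.heat t) \<le> 1 + 1"
        using norm_triangle_ineq4[of "blinfun_power (F ?\<tau>) n" "H.heat t"] H.norm_heat_le[OF t0]
          norm_blinfun_power[OF F_contraction[of ?\<tau>], of n] t0 by simp
      also have "\<dots> \<le> 2 * T / real n" using 3 n tT by (simp add: field_simps)
      also have "\<dots> \<le> c / real n" using c(2) by (intro divide_right_mono) auto
      finally show ?thesis by (simp add: e)
    qed
  qed
  show ?thesis
  proof (intro exI[of _ c] conjI allI impI)
    fix n :: nat assume "n \<ge> 1"
    then show "(SUP t\<in>I. ereal (norm (blinfun_power (F (t / real n)) n - op_exp D (\<lambda>x. - H x) t)))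
        \<le> ereal (c * (1 / real n))"
      using main by (intro SUP_least) (simp only: ereal_less_eq)
  qed (rule c(3))
qed

end
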